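(* Let $R$ be a local ring (with identity), let ${}_RM$ be a finitely generated semisimple left $R$-module and let $\varphi\in\mathrm{End}_R(M)$ be nilpotent of index $n$. Let $X=\{x_{\gamma,i}\mid 1\le\gamma\le m,\ 1\le i\le k_\gamma\}$ be a nilpotent Jordan normal base of ${}_RM$ with respect to $\varphi$, with $k_1\ge k_2\ge\cdots\ge k_m\ge 1$. If $f_i(x_1,\dots,x_r)\in Z(R)\langle x_1,\dots,x_r\rangle$, $1\le i\le n-1$, and each $f_i=0$ is a polynomial identity of the $Z(R)$-subalgebra $\mathcal{U}_0(X)$ of $\mathrm{M}_m^{\mathrm{op}}(R/J)$, then $f_1f_2\cdots f_{n-1}=0$ is an identity of the factor $\mathrm{Cen}(\varphi)/\mathrm{Cen}_0(\varphi)$.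
   Context: $Z(R)$ and $J=J(R)$ are the centre and the Jacobson radical of $R$; $R$ is local if $R/J$ is a division ring. $Z(R)\langle x_1,\dots,x_r\rangle$ is the ring of polynomials over $Z(R)$ in non-commuting indeterminates. $\mathrm{M}_m^{\mathrm{op}}(R/J)$ is the opposite of the full $m\times m$ matrix ring over $R/J$, a $Z(R)$-algebra via $Z(R)\to R\to R/J$. "$f=0$ is an identity of $A$" means that $f(v_1,\dots,v_r)=0$ for all $v_1,\dots,v_r\in A$; evaluations on $\mathcal{U}_0(X)$ (in particular of constant terms) are carried out in the unital $Z(R)$-algebra $\mathrm{M}_m^{\mathrm{op}}(R/J)$. For $n=1$ the empty product is $1$ (and then $\varphi=0$ and the factor algebra is zero). $\mathrm{Cen}(\varphi)=\{\psi\in\mathrm{End}_R(M)\mid\psi\circ\varphi=\varphi\circ\psi\}$, and $\mathrm{Cen}_0(\varphi)=\{\psi\in\mathrm{End}_R(M)\mid\psi\circ\varphi=\varphi\circ\psi=0\}$ is an ideal of it. Nilpotent Jordan normal base: a subset $X=\{x_{\gamma,i}\mid\gamma\in\Gamma,\ 1\le i\le k_\gamma\}\subseteq M$ such that each $Rx_{\gamma,i}$ is a simple submodule, $M=\bigoplus_{\gamma\in\Gamma,\,1\le i\le k_\gamma}Rx_{\gamma,i}$ (direct sum), $\varphi(x_{\gamma,i})=x_{\gamma,i+1}$ for $1\le i<k_\gamma$, $\varphi(x_{\gamma,k_\gamma})=0$, and $\{k_\gamma\}$ is bounded. Such a base exists for any nilpotent endomorphism of a semisimple module; here $M$ is finitely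 generated, $\Gamma=\{1,\dots,m\}$ with $m=\dim_R(\ker\varphi)$ (the number of simple summands of $\ker\varphi$), and the nilpotency index is $n=\max_\gamma k_\gamma$. $\mathcal{U}_0(X)=\{U=[u_{\delta,\gamma}]\in\mathrm{M}_m(R/J)\mid u_{\delta,\gamma}=0\text{ if }1\le k_\delta<k_\gamma\text{ or }k_\gamma=1\}$, a (block upper triangular) subalgebra of $\mathrm{M}_m(R/J)$, not necessarily containing the identity matrix. *)

theory Defs
  imports "HOL-Algebra.Algebra"
begin

section \<open>Local rings\<close>

definition left_ideal :: "('a, 'b) ring_scheme \<Rightarrow> 'a set \<Rightarrow> bool" where
  "left_ideal R I \<longleftrightarrow>
     additive_subgroup I R \<and> (\<forall>a\<in>carrier R. \<forall>x\<in>I. a \<otimes>\<^bsub>R\<^esub> x \<in> I)"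

definition maximal_left_ideal :: "('a, 'b) ring_scheme \<Rightarrow> 'a set \<Rightarrow> bool" where
  "maximal_left_ideal R I \<longleftrightarrow>
     left_ideal R I \<and> I \<noteq> carrier R \<and>
     (\<forall>L. left_ideal R L \<and> I \<subseteq> L \<longrightarrow> L = I \<or> L = carrier R)"

definition jacobson_radical :: "('a, 'b) ring_scheme \<Rightarrow> 'a set" where
  "jacobson_radical R = carrier R \<inter> \<Inter>{I. maximal_left_ideal R I}"

definition is_division_ring :: "('a, 'b) ring_scheme \<Rightarrow> bool" where
  "is_division_ring R \<longleftrightarrow>
     ring R \<and> \<one>\<^bsub>R\<^esub> \<noteq> \<zero>\<^bsub>R\<^esub> \<and> Units R = carrier R - {\<zero>\<^bsub>R\<^esub>}"

abbreviation residue_quotient :: "('a, 'b) ring_scheme \<Rightarrow> 'a set ring" where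
  "residue_quotient R \<equiv> R Quot (jacobson_radical R)"

definition is_local_ring :: "('a, 'b) ring_scheme \<Rightarrow> bool" where
  "is_local_ring R \<longleftrightarrow> ring R \<and> is_division_ring (residue_quotient R)"

definition center_ring :: "('a, 'b) ring_scheme \<Rightarrow> ('a, 'b) ring_scheme" where
  "center_ring R =
     R\<lparr>carrier := {c \<in> carrier R. \<forall>a\<in>carrier R. c \<otimes>\<^bsub>R\<^esub> a = a \<otimes>\<^bsub>R\<^esub> c}\<rparr>"

definition opposite_ring :: "('a, 'b) ring_scheme \<Rightarrow> ('a, 'b) ring_scheme" where
  "opposite_ring R = R\<lparr>monoid.mult := \<lambda>a b. b \<otimes>\<^bsub>R\<^esub> a\<rparr>"


section \<open>Left modules\<close>

text \<open>The locale \<open>module\<close> of HOL-Algebra requires a commutative ring of scalars.  Its record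
  type and its locale \<open>submodule\<close> do not, and they are reused here.  The multiplicative
  fields of the record of \<open>M\<close> play no role.\<close>

definition left_module :: "('a, 'b) ring_scheme \<Rightarrow> ('a, 'm, 'c) module_scheme \<Rightarrow> bool" where
  "left_module R M \<longleftrightarrow>
     ring R \<and> abelian_group M \<and>
     (\<forall>a\<in>carrier R. \<forall>x\<in>carrier M. a \<odot>\<^bsub>M\<^esub> x \<in> carrier M) \<and>
     (\<forall>a\<in>carrier R. \<forall>b\<in>carrier R. \<forall>x\<in>carrier M.
        (a \<oplus>\<^bsub>R\<^esub> b) \<odot>\<^bsub>M\<^esub> x = a \<odot>\<^bsub>M\<^esub> x \<oplus>\<^bsub>M\<^esub> b \<odot>\<^bsub>M\<^esub> x) \<and>
     (\<forall>a\<in>carrier R. \<forall>x\<in>carrier M. \<forall>y\<in>carrier M.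
        a \<odot>\<^bsub>M\<^esub> (x \<oplus>\<^bsub>M\<^esub> y) = a \<odot>\<^bsub>M\<^esub> x \<oplus>\<^bsub>M\<^esub> a \<odot>\<^bsub>M\<^esub> y) \<and>
     (\<forall>a\<in>carrier R. \<forall>b\<in>carrier R. \<forall>x\<in>carrier M.
        (a \<otimes>\<^bsub>R\<^esub> b) \<odot>\<^bsub>M\<^esub> x = a \<odot>\<^bsub>M\<^esub> (b \<odot>\<^bsub>M\<^esub> x)) \<and>
     (\<forall>x\<in>carrier M. \<one>\<^bsub>R\<^esub> \<odot>\<^bsub>M\<^esub> x = x)"

definition module_span ::
    "('a, 'b) ring_scheme \<Rightarrow> ('a, 'm, 'c) module_scheme \<Rightarrow> 'm set \<Rightarrow> 'm set" where
  "module_span R M S = \<Inter>{N. submodule N R M \<and> S \<subseteq> N}"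

definition finitely_generated_module ::
    "('a, 'b) ring_scheme \<Rightarrow> ('a, 'm, 'c) module_scheme \<Rightarrow> bool" where
  "finitely_generated_module R M \<longleftrightarrow>
     (\<exists>S. finite S \<and> S \<subseteq> carrier M \<and> module_span R M S = carrier M)"

definition simple_submodule ::
    "('a, 'b) ring_scheme \<Rightarrow> ('a, 'm, 'c) module_scheme \<Rightarrow> 'm set \<Rightarrow> bool" where
  "simple_submodule R M S \<longleftrightarrow>
     submodule S R M \<and> S \<noteq> {\<zero>\<^bsub>M\<^esub>} \<and>
     (\<forall>N. submodule N R M \<and> N \<subseteq> S \<longrightarrow> N = {\<zero>\<^bsub>M\<^esub>} \<or> N = S)"

definition semisimple_module ::
    "('a, 'b) ring_scheme \<Rightarrow> ('a, 'm, 'c) module_scheme \<Rightarrow> bool" where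
  "semisimple_module R M \<longleftrightarrow>
     module_span R M (\<Union>{S. simple_submodule R M S}) = carrier M"

definition cyclic_submodule ::
    "('a, 'b) ring_scheme \<Rightarrow> ('a, 'm, 'c) module_scheme \<Rightarrow> 'm \<Rightarrow> 'm set" where
  "cyclic_submodule R M x = {a \<odot>\<^bsub>M\<^esub> x | a. a \<in> carrier R}"

definition internal_direct_sum ::
    "('a, 'b) ring_scheme \<Rightarrow> ('a, 'm, 'c) module_scheme \<Rightarrow> 'i set \<Rightarrow> ('i \<Rightarrow> 'm set) \<Rightarrow> bool" where
  "internal_direct_sum R M I N \<longleftrightarrow>
     (\<forall>i\<in>I. submodule (N i) R M) \<and>
     (\<forall>y\<in>carrier M. \<exists>!g. g \<in> (\<Pi>\<^sub>E i\<in>I. N i) \<and> finite {i \<in> I. g i \<noteq> \<zero>\<^bsub>M\<^esub>} \<and>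
        y = (\<Oplus>\<^bsub>M\<^esub>i\<in>{i \<in> I. g i \<noteq> \<zero>\<^bsub>M\<^esub>}. g i))"


section \<open>Endomorphisms and centralizers\<close>

text \<open>Endomorphisms are written on the left.  They are extensional functions, so that equality
  in the ring below is equality on the carrier of \<open>M\<close>.\<close>

definition End_ring ::
    "('a, 'b) ring_scheme \<Rightarrow> ('a, 'm, 'c) module_scheme \<Rightarrow> ('m \<Rightarrow> 'm) ring" where
  "End_ring R M =
     \<lparr>carrier = {\<psi> \<in> carrier M \<rightarrow>\<^sub>E carrier M.
        (\<forall>x\<in>carrier M. \<forall>y\<in>carrier M. \<psi> (x \<oplus>\<^bsub>M\<^esub> y) = \<psi> x \<oplus>\<^bsub>M\<^esub> \<psi> y) \<and>
        (\<forall>a\<in>carrier R. \<forall>x\<in>carrier M. \<psi> (a \<odot>\<^bsub>M\<^esub> x) = a \<odot>\<^bsub>M\<^esub> \<psi> x)},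
      monoid.mult = \<lambda>\<psi> \<theta>. compose (carrier M) \<psi> \<theta>,
      monoid.one = \<lambda>x\<in>carrier M. x,
      ring.zero = \<lambda>x\<in>carrier M. \<zero>\<^bsub>M\<^esub>,
      ring.add = \<lambda>\<psi> \<theta>. \<lambda>x\<in>carrier M. \<psi> x \<oplus>\<^bsub>M\<^esub> \<theta> x\<rparr>"

text \<open>The index is the least positive exponent; thus the zero endomorphism has index 1, also
  on the zero module.\<close>

definition nilpotent_of_index :: "('a, 'b) ring_scheme \<Rightarrow> 'a \<Rightarrow> nat \<Rightarrow> bool" where
  "nilpotent_of_index E \<phi> n \<longleftrightarrow>
     1 \<le> n \<and> \<phi> [^]\<^bsub>E\<^esub> n = \<zero>\<^bsub>E\<^esub> \<and> (\<forall>j. 1 \<le> j \<and> j < n \<longrightarrow> \<phi> [^]\<^bsub>E\<^esub> j \<noteq> \<zero>\<^bsub>E\<^esub>)"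

definition Cen ::
    "('a, 'b) ring_scheme \<Rightarrow> ('a, 'm, 'c) module_scheme \<Rightarrow> ('m \<Rightarrow> 'm) \<Rightarrow> ('m \<Rightarrow> 'm) ring" where
  "Cen R M \<phi> = (End_ring R M)\<lparr>carrier :=
     {\<psi> \<in> carrier (End_ring R M). \<psi> \<otimes>\<^bsub>End_ring R M\<^esub> \<phi> = \<phi> \<otimes>\<^bsub>End_ring R M\<^esub> \<psi>}\<rparr>"

definition Cen0 ::
    "('a, 'b) ring_scheme \<Rightarrow> ('a, 'm, 'c) module_scheme \<Rightarrow> ('m \<Rightarrow> 'm) \<Rightarrow> ('m \<Rightarrow> 'm) set" where
  "Cen0 R M \<phi> = {\<psi> \<in> carrier (End_ring R M).
     \<psi> \<otimes>\<^bsub>End_ring R M\<^esub> \<phi> = \<zero>\<^bsub>End_ring R M\<^esub> \<and> \<phi> \<otimes>\<^bsub>End_ring R M\<^esub> \<psi> = \<zero>\<^bsub>End_ring R M\<^esub>}"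

text \<open>The structure map of the \<open>Z(R)\<close>-algebra \<open>Cen(\<phi>)/Cen\<^sub>0(\<phi>)\<close>.\<close>

definition Cen_quot_scalar ::
    "('a, 'b) ring_scheme \<Rightarrow> ('a, 'm, 'c) module_scheme \<Rightarrow> ('m \<Rightarrow> 'm) \<Rightarrow> 'a \<Rightarrow> ('m \<Rightarrow> 'm) set" where
  "Cen_quot_scalar R M \<phi> c = Cen0 R M \<phi> +>\<^bsub>Cen R M \<phi>\<^esub> (\<lambda>x\<in>carrier M. c \<odot>\<^bsub>M\<^esub> x)"

definition nilpotent_jordan_base ::
    "('a, 'b) ring_scheme \<Rightarrow> ('a, 'm, 'c) module_scheme \<Rightarrow> ('m \<Rightarrow> 'm) \<Rightarrow>
     'g set \<Rightarrow> ('g \<Rightarrow> nat) \<Rightarrow> ('g \<Rightarrow> nat \<Rightarrow> 'm) \<Rightarrow> bool" where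
  "nilpotent_jordan_base R M \<phi> \<Gamma> k x \<longleftrightarrow>
     (\<forall>\<gamma>\<in>\<Gamma>. \<forall>i\<in>{1..k \<gamma>}. x \<gamma> i \<in> carrier M \<and>
        simple_submodule R M (cyclic_submodule R M (x \<gamma> i))) \<and>
     internal_direct_sum R M (SIGMA \<gamma>:\<Gamma>. {1..k \<gamma>})
       (\<lambda>(\<gamma>, i). cyclic_submodule R M (x \<gamma> i)) \<and>
     (\<forall>\<gamma>\<in>\<Gamma>. 1 \<le> k \<gamma>) \<and>
     (\<forall>\<gamma>\<in>\<Gamma>. \<forall>i. 1 \<le> i \<and> i < k \<gamma> \<longrightarrow> \<phi> (x \<gamma> i) = x \<gamma> (Suc i)) \<and>
     (\<forall>\<gamma>\<in>\<Gamma>. \<phi> (x \<gamma> (k \<gamma>)) = \<zero>\<^bsub>M\<^esub>) \<and>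
     (\<exists>b. \<forall>\<gamma>\<in>\<Gamma>. k \<gamma> \<le> b)"


section \<open>Matrices\<close>

text \<open>An \<open>m \<times> m\<close> matrix is an extensional function on \<open>{1..m} \<times> {1..m}\<close>, the first component
  being the row.\<close>

definition mat_ring :: "('a, 'b) ring_scheme \<Rightarrow> nat \<Rightarrow> (nat \<times> nat \<Rightarrow> 'a) ring" where
  "mat_ring S m =
     \<lparr>carrier = {1..m} \<times> {1..m} \<rightarrow>\<^sub>E carrier S,
      monoid.mult = \<lambda>A B. \<lambda>(i, j)\<in>{1..m} \<times> {1..m}. \<Oplus>\<^bsub>S\<^esub>l\<in>{1..m}. A (i, l) \<otimes>\<^bsub>S\<^esub> B (l, j),
      monoid.one = \<lambda>(i, j)\<in>{1..m} \<times> {1..m}. if i = j then \<one>\<^bsub>S\<^esub> else \<zero>\<^bsub>S\<^esub>,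
      ring.zero = \<lambda>(i, j)\<in>{1..m} \<times> {1..m}. \<zero>\<^bsub>S\<^esub>,
      ring.add = \<lambda>A B. \<lambda>(i, j)\<in>{1..m} \<times> {1..m}. A (i, j) \<oplus>\<^bsub>S\<^esub> B (i, j)\<rparr>"

text \<open>The structure map of the \<open>Z(R)\<close>-algebra of matrices over \<open>R/J\<close>: scalar matrices, via
  \<open>Z(R) \<rightarrow> R \<rightarrow> R/J\<close>.\<close>

definition mat_scalar :: "('a, 'b) ring_scheme \<Rightarrow> nat \<Rightarrow> 'a \<Rightarrow> (nat \<times> nat \<Rightarrow> 'a set)" where
  "mat_scalar R m c = (\<lambda>(i, j)\<in>{1..m} \<times> {1..m}.
     if i = j then jacobson_radical R +>\<^bsub>R\<^esub> c else \<zero>\<^bsub>residue_quotient R\<^esub>)"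

text \<open>The subalgebra \<open>\<U>\<^sub>0(X)\<close>; it depends on \<open>X\<close> only through the lengths \<open>k\<close> of the chains.\<close>

definition U0 :: "('a, 'b) ring_scheme \<Rightarrow> nat \<Rightarrow> (nat \<Rightarrow> nat) \<Rightarrow> (nat \<times> nat \<Rightarrow> 'a set) set" where
  "U0 R m k = {u \<in> carrier (mat_ring (residue_quotient R) m).
     \<forall>\<delta>\<in>{1..m}. \<forall>\<gamma>\<in>{1..m}.
       (1 \<le> k \<delta> \<and> k \<delta> < k \<gamma>) \<or> k \<gamma> = 1 \<longrightarrow> u (\<delta>, \<gamma>) = \<zero>\<^bsub>residue_quotient R\<^esub>}"


section \<open>Polynomials in non-commuting indeterminates\<close>

text \<open>A polynomial in the indeterminates \<open>x\<^sub>1, \<dots>, x\<^sub>r\<close> is given by its coefficients at the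
  words over \<open>{1..r}\<close>, which represent the monomials.\<close>

definition ncpoly_support :: "('a, 'b) ring_scheme \<Rightarrow> (nat list \<Rightarrow> 'a) \<Rightarrow> nat list set" where
  "ncpoly_support K f = {w. f w \<noteq> \<zero>\<^bsub>K\<^esub>}"

definition ncpoly_ring :: "('a, 'b) ring_scheme \<Rightarrow> nat \<Rightarrow> (nat list \<Rightarrow> 'a) ring" where
  "ncpoly_ring K r =
     \<lparr>carrier = {f. range f \<subseteq> carrier K \<and> finite (ncpoly_support K f) \<and>
        ncpoly_support K f \<subseteq> lists {1..r}},
      monoid.mult = \<lambda>f g w. \<Oplus>\<^bsub>K\<^esub>i\<in>{..length w}. f (take i w) \<otimes>\<^bsub>K\<^esub> g (drop i w),
      monoid.one = \<lambda>w. if w = [] then \<one>\<^bsub>K\<^esub> else \<zero>\<^bsub>K\<^esub>,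
      ring.zero = \<lambda>w. \<zero>\<^bsub>K\<^esub>,
      ring.add = \<lambda>f g w. f w \<oplus>\<^bsub>K\<^esub> g w\<rparr>"

text \<open>Products of lists of ring elements, in the given order; the empty product is 1.\<close>

definition list_product :: "('a, 'b) ring_scheme \<Rightarrow> 'a list \<Rightarrow> 'a" where
  "list_product A as = foldr (\<lambda>a b. a \<otimes>\<^bsub>A\<^esub> b) as \<one>\<^bsub>A\<^esub>"

text \<open>Evaluation in a unital algebra \<open>A\<close> over the commutative ring \<open>K\<close>, the algebra structure
  being given by the ring homomorphism \<open>\<sigma>\<close> from \<open>K\<close> to the centre of \<open>A\<close>.\<close>

definition ncpoly_eval ::
    "('a, 'b) ring_scheme \<Rightarrow> ('c, 'd) ring_scheme \<Rightarrow> ('a \<Rightarrow> 'c) \<Rightarrow> (nat list \<Rightarrow> 'a) \<Rightarrow> (nat \<Rightarrow> 'c) \<Rightarrow> 'c" where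
  "ncpoly_eval K A \<sigma> f v =
     (\<Oplus>\<^bsub>A\<^esub>w\<in>ncpoly_support K f. \<sigma> (f w) \<otimes>\<^bsub>A\<^esub> list_product A (map v w))"

text \<open>\<open>f = 0\<close> is an identity of the (not necessarily unital) subalgebra \<open>S\<close> of \<open>A\<close>; the
  evaluations take place in \<open>A\<close>.\<close>

definition polynomial_identity_on ::
    "('a, 'b) ring_scheme \<Rightarrow> nat \<Rightarrow> ('c, 'd) ring_scheme \<Rightarrow> ('a \<Rightarrow> 'c) \<Rightarrow> 'c set \<Rightarrow>
     (nat list \<Rightarrow> 'a) \<Rightarrow> bool" where
  "polynomial_identity_on K r A \<sigma> S f \<longleftrightarrow>
     (\<forall>v\<in>{1..r} \<rightarrow> S. ncpoly_eval K A \<sigma> f v = \<zero>\<^bsub>A\<^esub>)"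

end

theory Submission
  imports Defs
begin

text \<open>Put \<open>N = im \<phi> + ker \<phi>\<close>. Every \<open>\<psi>\<close> in \<open>Cen(\<phi>)\<close> preserves \<open>N\<close>, so it acts on \<open>M/N\<close>, which is spanned
  by the classes of the chain heads \<open>x\<^bsub>\<gamma>,1\<^esub>\<close> with \<open>k\<^bsub>\<gamma>\<^esub> \<ge> 2\<close>; the other heads lie in \<open>ker \<phi>\<close>. The
  scalars act through \<open>R/J\<close>, because the annihilator of a generator of a simple module over a
  local ring is \<open>J\<close> (\<open>annihilator_simple_local\<close>). Write \<open>\<psi>(x\<^bsub>\<delta>,1\<^esub>)\<close> as a combination of the heads
  modulo \<open>N\<close>, with coefficients in row \<open>\<delta>\<close> of a matrix. The coefficient at \<open>x\<^bsub>\<gamma>,1\<^esub>\<close> vanishes if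
  \<open>k\<^bsub>\<delta>\<^esub> < k\<^bsub>\<gamma>\<^esub>\<close>, since \<open>\<phi>\<close> to the power \<open>k\<^bsub>\<delta>\<^esub>\<close> kills \<open>\<psi>(x\<^bsub>\<delta>,1\<^esub>)\<close> but moves \<open>x\<^bsub>\<gamma>,1\<^esub>\<close> to
  a later element of its chain; and it may be taken to be 0 if \<open>k\<^bsub>\<gamma>\<^esub> = 1\<close>. So \<open>\<psi>\<close> has a matrix
  in \<open>\<U>\<^sub>0(X)\<close> (\<open>ex_U0_represents\<close>). As coefficients are scalars on the left and maps are composed on
  the left, the matrix of \<open>\<psi>\<theta>\<close> is that of \<open>\<theta>\<close> times that of \<open>\<psi>\<close>, which is the product of the opposite
  matrix ring.

  Consequently, if \<open>f\<^sub>i = 0\<close> is an identity of \<open>\<U>\<^sub>0(X)\<close>, then every value \<open>g\<^sub>i\<close> of \<open>f\<^sub>i\<close> on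
  \<open>Cen(\<phi>)\<close> has the zero matrix, that is, \<open>g\<^sub>i M \<subseteq> N\<close>, or \<open>\<phi> g\<^sub>i M \<subseteq> \<phi>\<^sup>2 M\<close>
  (\<open>identity_maps_to_radical\<close>). Since the \<open>g\<^sub>i\<close> commute with \<open>\<phi>\<close>, each factor gains one power of
  \<open>\<phi>\<close>, and \<open>\<phi> g\<^sub>1 \<cdots> g\<^sub>n\<^sub>-\<^sub>1 M \<subseteq> \<phi>\<^sup>n M = 0\<close> (\<open>radical_product_depth\<close>). This says exactly that the
  product is in \<open>Cen\<^sub>0(\<phi>)\<close>.

  What remains is bookkeeping about evaluation: it is compatible with relations between two rings that
  respect the operations, such as homomorphisms and the relation between endomorphisms and matrices
  (\<open>ncpoly_eval_related\<close>), and it is multiplicative (\<open>ncpoly_eval_mult\<close>).\<close>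

section \<open>Finite sums\<close>

lemma (in abelian_monoid) finsum_Sigma:
  assumes "finite A" "\<And>i. i \<in> A \<Longrightarrow> finite (B i)"
    and "\<And>i j. i \<in> A \<Longrightarrow> j \<in> B i \<Longrightarrow> g i j \<in> carrier G"
  shows "(\<Oplus>i\<in>A. \<Oplus>j\<in>B i. g i j) = (\<Oplus>p\<in>Sigma A B. g (fst p) (snd p))"
  using assms
proof (induction A rule: finite_induct)
  case empty
  then show ?case by simp
next
  case (insert a A)
  have split: "Sigma (insert a A) B = Pair a ` B a \<union> Sigma A B"
    by auto
  have "(\<Oplus>p\<in>Sigma (insert a A) B. g (fst p) (snd p)) =
      (\<Oplus>p\<in>Pair a ` B a. g (fst p) (snd p)) \<oplus> (\<Oplus>p\<in>Sigma A B. g (fst p) (snd p))"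
    unfolding split using insert by (intro finsum_Un_disjoint) auto
  also have "(\<Oplus>p\<in>Pair a ` B a. g (fst p) (snd p)) = (\<Oplus>j\<in>B a. g a j)"
    using insert.prems by (subst finsum_reindex) (auto simp: inj_on_def)
  also have "(\<Oplus>p\<in>Sigma A B. g (fst p) (snd p)) = (\<Oplus>i\<in>A. \<Oplus>j\<in>B i. g i j)"
    using insert by simp
  finally show ?case
    using insert by (subst finsum_insert) (auto intro!: finsum_closed)
qed

lemma (in abelian_monoid) finsum_swap:
  assumes "finite A" "finite B" "\<And>i j. i \<in> A \<Longrightarrow> j \<in> B \<Longrightarrow> g i j \<in> carrier G"
  shows "(\<Oplus>i\<in>A. \<Oplus>j\<in>B. g i j) = (\<Oplus>j\<in>B. \<Oplus>i\<in>A. g i j)"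
  using assms
proof (induction A rule: finite_induct)
  case empty
  then show ?case by simp
next
  case (insert a A)
  have "(\<Oplus>j\<in>B. \<Oplus>i\<in>insert a A. g i j) = (\<Oplus>j\<in>B. g a j \<oplus> (\<Oplus>i\<in>A. g i j))"
    using insert by (intro finsum_cong') (auto intro!: finsum_closed)
  also have "\<dots> = (\<Oplus>j\<in>B. g a j) \<oplus> (\<Oplus>j\<in>B. \<Oplus>i\<in>A. g i j)"
    using insert by (intro finsum_addf) (auto intro!: finsum_closed)
  finally show ?case
    using insert by (subst finsum_insert) (auto intro!: finsum_closed)
qed

lemma additive_finsum:
  assumes "abelian_group G" "abelian_group H" "h \<in> carrier G \<rightarrow> carrier H"
    and add: "\<And>a b. a \<in> carrier G \<Longrightarrow> b \<in> carrier G \<Longrightarrow> h (a \<oplus>\<^bsub>G\<^esub> b) = h a \<oplus>\<^bsub>H\<^esub> h b"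
    and g: "g \<in> A \<rightarrow> carrier G"
  shows "h (finsum G g A) = (\<Oplus>\<^bsub>H\<^esub>i\<in>A. h (g i))"
proof -
  interpret G: abelian_group G by fact
  interpret H: abelian_group H by fact
  have h: "h a \<in> carrier H" if "a \<in> carrier G" for a
    using assms(3) that by auto
  have "h \<zero>\<^bsub>G\<^esub> \<oplus>\<^bsub>H\<^esub> h \<zero>\<^bsub>G\<^esub> = h \<zero>\<^bsub>G\<^esub>"
    using add[of "\<zero>\<^bsub>G\<^esub>" "\<zero>\<^bsub>G\<^esub>"] by simp
  then have zero: "h \<zero>\<^bsub>G\<^esub> = \<zero>\<^bsub>H\<^esub>"
    using h by (simp add: H.add.r_cancel_one')
  show ?thesis
  proof (cases "finite A")
    case True
    then show ?thesis
      using g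
    proof (induction A rule: finite_induct)
      case (insert a A)
      have "h (finsum G g (insert a A)) = h (g a \<oplus>\<^bsub>G\<^esub> finsum G g A)"
        using insert by (subst G.finsum_insert) auto
      also have "\<dots> = h (g a) \<oplus>\<^bsub>H\<^esub> h (finsum G g A)"
        using insert by (intro add) (auto intro!: G.finsum_closed)
      finally show ?case
        using insert h by (subst H.finsum_insert) (auto simp: Pi_iff)
    qed (simp add: zero)
  qed (simp add: zero G.finsum_infinite H.finsum_infinite)
qed

section \<open>Evaluation of noncommutative polynomials\<close>

lemma list_product_simps [simp]:
  "list_product A [] = \<one>\<^bsub>A\<^esub>"
  "list_product A (a # as) = a \<otimes>\<^bsub>A\<^esub> list_product A as"
  by (simp_all add: list_product_def)

lemma (in ring) list_product_closed:
  "set as \<subseteq> carrier R \<Longrightarrow> list_product R as \<in> carrier R"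
  by (induction as) auto

lemma (in ring) list_product_append:
  "set as \<subseteq> carrier R \<Longrightarrow> set bs \<subseteq> carrier R \<Longrightarrow>
    list_product R (as @ bs) = list_product R as \<otimes> list_product R bs"
  by (induction as) (auto simp: list_product_closed m_assoc)

text \<open>Formulated for a relation rather than a map because it is applied both to the projection onto
  a factor ring and to the relation between an endomorphism and the matrices that describe it, which
  is not functional in either direction. For the second use, \<open>A\<close> and \<open>B\<close> are abelian
  monoids, so that matrices qualify by their addition alone.\<close>

lemma ncpoly_eval_related:
  assumes "abelian_monoid A" "abelian_monoid B"
    and carr: "\<And>a b. P a b \<Longrightarrow> a \<in> carrier A \<and> b \<in> carrier B"
    and zero: "P \<zero>\<^bsub>A\<^esub> \<zero>\<^bsub>B\<^esub>"
    and one: "P \<one>\<^bsub>A\<^esub> \<one>\<^bsub>B\<^esub>"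
    and add: "\<And>a b a' b'. P a b \<Longrightarrow> P a' b' \<Longrightarrow> P (a \<oplus>\<^bsub>A\<^esub> a') (b \<oplus>\<^bsub>B\<^esub> b')"
    and mult: "\<And>a b a' b'. P a b \<Longrightarrow> P a' b' \<Longrightarrow> P (a \<otimes>\<^bsub>A\<^esub> a') (b \<otimes>\<^bsub>B\<^esub> b')"
    and scalar: "\<And>c. c \<in> carrier K \<Longrightarrow> P (\<sigma> c) (\<tau> c)"
    and f: "f \<in> carrier (ncpoly_ring K r)"
    and vals: "\<And>j. j \<in> {1..r} \<Longrightarrow> P (v j) (u j)"
  shows "P (ncpoly_eval K A \<sigma> f v) (ncpoly_eval K B \<tau> f u)"
proof -
  interpret A: abelian_monoid A by fact
  interpret B: abelian_monoid B by fact
  have "P (list_product A (map v w)) (list_product B (map u w))" if "w \<in> lists {1..r}" for w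
    using that by (induction w) (auto intro!: one mult vals)
  then have monomial: "P (\<sigma> (f w) \<otimes>\<^bsub>A\<^esub> list_product A (map v w))
      (\<tau> (f w) \<otimes>\<^bsub>B\<^esub> list_product B (map u w))" if "w \<in> ncpoly_support K f" for w
    using that f by (intro mult scalar) (auto simp: ncpoly_ring_def)
  have "P (\<Oplus>\<^bsub>A\<^esub>w\<in>W. \<sigma> (f w) \<otimes>\<^bsub>A\<^esub> list_product A (map v w))
      (\<Oplus>\<^bsub>B\<^esub>w\<in>W. \<tau> (f w) \<otimes>\<^bsub>B\<^esub> list_product B (map u w))"
    if "finite W" "W \<subseteq> ncpoly_support K f" for W
    using that
  proof (induction W rule: finite_induct)
    case (insert w W)
    let ?s = "\<lambda>w. \<sigma> (f w) \<otimes>\<^bsub>A\<^esub> list_product A (map v w)"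
    let ?t = "\<lambda>w. \<tau> (f w) \<otimes>\<^bsub>B\<^esub> list_product B (map u w)"
    have st: "P (?s x) (?t x)" if "x \<in> insert w W" for x
      using monomial insert.prems that by blast
    then have "P (?s w \<oplus>\<^bsub>A\<^esub> finsum A ?s W) (?t w \<oplus>\<^bsub>B\<^esub> finsum B ?t W)"
      using insert by (intro add) auto
    moreover have "finsum A ?s (insert w W) = ?s w \<oplus>\<^bsub>A\<^esub> finsum A ?s W"
      using st carr insert.hyps by (intro A.finsum_insert) blast+
    moreover have "finsum B ?t (insert w W) = ?t w \<oplus>\<^bsub>B\<^esub> finsum B ?t W"
      using st carr insert.hyps by (intro B.finsum_insert) blast+
    ultimately show ?case
      by simp
  qed (simp add: zero)
  then show ?thesis
    unfolding ncpoly_eval_def using f by (auto simp: ncpoly_ring_def)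
qed

lemma (in ring) ncpoly_mult_zero:
  assumes f: "f \<in> carrier (ncpoly_ring R r)" and g: "g \<in> carrier (ncpoly_ring R r)"
    and w: "w \<notin> (\<lambda>(a, b). a @ b) ` (ncpoly_support R f \<times> ncpoly_support R g)"
  shows "(f \<otimes>\<^bsub>ncpoly_ring R r\<^esub> g) w = \<zero>"
proof -
  have carr: "f a \<in> carrier R" "g a \<in> carrier R" for a
    using f g by (auto simp: ncpoly_ring_def)
  have "f (take i w) \<otimes> g (drop i w) = \<zero>" for i
  proof (rule ccontr)
    assume *: "f (take i w) \<otimes> g (drop i w) \<noteq> \<zero>"
    then have "take i w \<in> ncpoly_support R f" "drop i w \<in> ncpoly_support R g"
      using carr by (auto simp: ncpoly_support_def)
    then show False
      using w append_take_drop_id[of i w] by (force simp: image_iff)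
  qed
  then show ?thesis
    by (simp add: ncpoly_ring_def)
qed

lemma (in ring) ncpoly_mult_closed:
  assumes f: "f \<in> carrier (ncpoly_ring R r)" and g: "g \<in> carrier (ncpoly_ring R r)"
  shows "f \<otimes>\<^bsub>ncpoly_ring R r\<^esub> g \<in> carrier (ncpoly_ring R r)"
proof -
  let ?W = "(\<lambda>(a, b). a @ b) ` (ncpoly_support R f \<times> ncpoly_support R g)"
  have supp: "ncpoly_support R (f \<otimes>\<^bsub>ncpoly_ring R r\<^esub> g) \<subseteq> ?W"
    using ncpoly_mult_zero[OF f g] by (auto simp: ncpoly_support_def)
  have "finite ?W"
    using f g by (auto simp: ncpoly_ring_def)
  moreover have "ncpoly_support R f \<subseteq> lists {1..r}" "ncpoly_support R g \<subseteq> lists {1..r}"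
    using f g by (simp_all add: ncpoly_ring_def)
  then have "?W \<subseteq> lists {1..r}"
    unfolding lists_eq_set by fastforce
  moreover have "range (f \<otimes>\<^bsub>ncpoly_ring R r\<^esub> g) \<subseteq> carrier R"
    using f g by (auto simp: ncpoly_ring_def intro!: finsum_closed m_closed)
  ultimately show ?thesis
    using supp finite_subset[OF supp] by (auto simp: ncpoly_ring_def)
qed

lemma (in ring) ncpoly_one_closed: "\<one>\<^bsub>ncpoly_ring R r\<^esub> \<in> carrier (ncpoly_ring R r)"
proof -
  have "ncpoly_support R \<one>\<^bsub>ncpoly_ring R r\<^esub> \<subseteq> {[]}"
    by (auto simp: ncpoly_ring_def ncpoly_support_def)
  then show ?thesis
    using finite_subset[of _ "{[]}"] by (auto simp: ncpoly_ring_def)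
qed

lemma (in ring) ncpoly_list_product_closed:
  "set fs \<subseteq> carrier (ncpoly_ring R r) \<Longrightarrow> list_product (ncpoly_ring R r) fs \<in> carrier (ncpoly_ring R r)"
  by (induction fs) (auto simp: ncpoly_one_closed ncpoly_mult_closed)

text \<open>Centrality of the scalars is what makes evaluation multiplicative: the coefficients of the
  second factor have to be moved past the monomials of the first.\<close>

locale central_algebra = ring_hom_ring K A \<sigma>
  for K :: "('k, 'b) ring_scheme" and A :: "('a, 'c) ring_scheme" and \<sigma> :: "'k \<Rightarrow> 'a" +
  assumes central: "c \<in> carrier K \<Longrightarrow> a \<in> carrier A \<Longrightarrow> \<sigma> c \<otimes>\<^bsub>A\<^esub> a = a \<otimes>\<^bsub>A\<^esub> \<sigma> c"
begin

lemma ncpoly_eval_one: "ncpoly_eval K A \<sigma> \<one>\<^bsub>ncpoly_ring K r\<^esub> v = \<one>\<^bsub>A\<^esub>"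
proof -
  let ?one = "\<one>\<^bsub>ncpoly_ring K r\<^esub>"
  have sub: "ncpoly_support K ?one \<subseteq> {[]}"
    by (auto simp: ncpoly_ring_def ncpoly_support_def)
  have "ncpoly_eval K A \<sigma> ?one v = (\<Oplus>\<^bsub>A\<^esub>w\<in>{[]}. \<sigma> (?one w) \<otimes>\<^bsub>A\<^esub> list_product A (map v w))"
    unfolding ncpoly_eval_def using sub
    by (intro S.add.finprod_mono_neutral_cong_left)
      (auto simp: ncpoly_support_def ncpoly_ring_def simp flip: hom_one split: if_splits)
  also have "\<dots> = \<one>\<^bsub>A\<^esub>"
    by (simp add: ncpoly_ring_def)
  finally show ?thesis .
qed

text \<open>Both sides are the sum, over pairs of a word \<open>a\<close> of the support of \<open>f\<close> and a word \<open>b\<close> of the support of \<open>g\<close>, of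
  the products of the two corresponding terms. On the left these terms are indexed by the word
  \<open>a @ b\<close> together with the place where it is cut.\<close>

lemma ncpoly_eval_mult:
  assumes f: "f \<in> carrier (ncpoly_ring K r)" and g: "g \<in> carrier (ncpoly_ring K r)"
    and v: "v \<in> {1..r} \<rightarrow> carrier A"
  shows "ncpoly_eval K A \<sigma> (f \<otimes>\<^bsub>ncpoly_ring K r\<^esub> g) v =
    ncpoly_eval K A \<sigma> f v \<otimes>\<^bsub>A\<^esub> ncpoly_eval K A \<sigma> g v"
proof -
  define p where "p w = list_product A (map v w)" for w
  define t where "t a b = (\<sigma> (f a) \<otimes>\<^bsub>A\<^esub> p a) \<otimes>\<^bsub>A\<^esub> (\<sigma> (g b) \<otimes>\<^bsub>A\<^esub> p b)" for a b
  define L where "L = lists {1..r}"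
  define F where "F = ncpoly_support K f"
  define G where "G = ncpoly_support K g"
  \<comment> \<open>The support of the product may be smaller than \<open>W\<close> because of cancellation.\<close>
  define W where "W = (\<lambda>(a, b). a @ b) ` (F \<times> G)"
  define fg where "fg = f \<otimes>\<^bsub>ncpoly_ring K r\<^esub> g"
  have fin: "finite F" "finite G" "finite W" and lists: "F \<subseteq> L" "G \<subseteq> L"
    using f g by (auto simp: F_def G_def W_def L_def ncpoly_ring_def)
  have coeff [simp]: "f a \<in> carrier K" "g a \<in> carrier K" for a
    using f g by (auto simp: ncpoly_ring_def)
  have p [simp]: "p w \<in> carrier A" if "w \<in> L" for w
    unfolding p_def using v that by (intro S.list_product_closed) (auto simp: L_def)
  have p_append: "p (a @ b) = p a \<otimes>\<^bsub>A\<^esub> p b" if "a \<in> L" "b \<in> L" for a b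
    unfolding p_def using v that by (auto simp: Pi_iff L_def intro!: S.list_product_append)
  have W: "w \<in> L" if "w \<in> W" for w
    using that lists unfolding W_def L_def lists_eq_set by fastforce
  have lists_split: "take i w \<in> L" "drop i w \<in> L" if "w \<in> L" for w i
    using that by (auto simp: L_def dest: in_set_takeD in_set_dropD)
  have t: "t a b \<in> carrier A" if "a \<in> L" "b \<in> L" for a b
    using that by (simp add: t_def)
  have t_zero: "t a b = \<zero>\<^bsub>A\<^esub>" if "a \<in> L" "b \<in> L" "a \<notin> F \<or> b \<notin> G" for a b
    using that by (auto simp: t_def F_def G_def ncpoly_support_def)
  have t_FG: "t a b \<in> carrier A" if "a \<in> F" "b \<in> G" for a b
    using t lists that by blast
  have term_closed: "a \<in> F \<Longrightarrow> \<sigma> (f a) \<otimes>\<^bsub>A\<^esub> p a \<in> carrier A"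
    "b \<in> G \<Longrightarrow> \<sigma> (g b) \<otimes>\<^bsub>A\<^esub> p b \<in> carrier A" for a b
    using p lists by (auto intro!: S.m_closed)
  have split_term: "\<sigma> (f a \<otimes>\<^bsub>K\<^esub> g b) \<otimes>\<^bsub>A\<^esub> p (a @ b) = t a b"
    if "a \<in> L" "b \<in> L" for a b
  proof -
    have "\<sigma> (f a \<otimes>\<^bsub>K\<^esub> g b) \<otimes>\<^bsub>A\<^esub> p (a @ b) = \<sigma> (f a) \<otimes>\<^bsub>A\<^esub> ((\<sigma> (g b) \<otimes>\<^bsub>A\<^esub> p a) \<otimes>\<^bsub>A\<^esub> p b)"
      using that by (simp add: p_append S.m_assoc)
    also have "\<sigma> (g b) \<otimes>\<^bsub>A\<^esub> p a = p a \<otimes>\<^bsub>A\<^esub> \<sigma> (g b)"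
      using that by (simp add: central)
    finally show ?thesis
      using that by (simp add: t_def S.m_assoc)
  qed
  have coeff_term: "\<sigma> (fg w) \<otimes>\<^bsub>A\<^esub> p w = (\<Oplus>\<^bsub>A\<^esub>i\<in>{..length w}. t (take i w) (drop i w))"
    if w: "w \<in> L" for w
  proof -
    have "\<sigma> (fg w) = (\<Oplus>\<^bsub>A\<^esub>i\<in>{..length w}. \<sigma> (f (take i w) \<otimes>\<^bsub>K\<^esub> g (drop i w)))"
      unfolding fg_def ncpoly_ring_def monoid.simps
      by (rule additive_finsum) (auto simp: R.abelian_group_axioms S.abelian_group_axioms)
    then have "\<sigma> (fg w) \<otimes>\<^bsub>A\<^esub> p w =
        (\<Oplus>\<^bsub>A\<^esub>i\<in>{..length w}. \<sigma> (f (take i w) \<otimes>\<^bsub>K\<^esub> g (drop i w)) \<otimes>\<^bsub>A\<^esub> p w)"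
      using w by (simp add: S.finsum_ldistr del: hom_mult)
    moreover have "\<sigma> (f (take i w) \<otimes>\<^bsub>K\<^esub> g (drop i w)) \<otimes>\<^bsub>A\<^esub> p w = t (take i w) (drop i w)" for i
      using split_term[of "take i w" "drop i w"] lists_split[OF w] by (simp del: hom_mult)
    ultimately show ?thesis
      by simp
  qed
  have "ncpoly_eval K A \<sigma> fg v = (\<Oplus>\<^bsub>A\<^esub>w\<in>W. \<sigma> (fg w) \<otimes>\<^bsub>A\<^esub> p w)"
    unfolding ncpoly_eval_def p_def[symmetric]
  proof (rule S.add.finprod_mono_neutral_cong_left)
    show sub: "ncpoly_support K fg \<subseteq> W"
      unfolding fg_def W_def F_def G_def using R.ncpoly_mult_zero[OF f g]
      by (auto simp: ncpoly_support_def)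
    show "\<sigma> (fg w) \<otimes>\<^bsub>A\<^esub> p w = \<zero>\<^bsub>A\<^esub>" if "w \<in> W - ncpoly_support K fg" for w
      using that W by (auto simp: ncpoly_support_def)
    show "(\<lambda>w. \<sigma> (fg w) \<otimes>\<^bsub>A\<^esub> p w) \<in> W \<rightarrow> carrier A"
      using W R.ncpoly_mult_closed[OF f g] by (auto simp: fg_def ncpoly_ring_def)
  qed (use fin in auto)
  also have "\<dots> = (\<Oplus>\<^bsub>A\<^esub>w\<in>W. \<Oplus>\<^bsub>A\<^esub>i\<in>{..length w}. t (take i w) (drop i w))"
    using W t lists_split coeff_term by (intro S.finsum_cong') (auto intro!: S.finsum_closed)
  also have "\<dots> = (\<Oplus>\<^bsub>A\<^esub>q\<in>(SIGMA w:W. {..length w}). t (take (snd q) (fst q)) (drop (snd q) (fst q)))"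
    using W t lists_split fin by (intro S.finsum_Sigma) auto
  \<comment> \<open>A word may also be cut into pieces outside the supports; these contribute 0.\<close>
  also have "\<dots> = (\<Oplus>\<^bsub>A\<^esub>q\<in>(\<lambda>(a, b). (a @ b, length a)) ` (F \<times> G).
      t (take (snd q) (fst q)) (drop (snd q) (fst q)))"
  proof (rule S.add.finprod_mono_neutral_cong_right)
    show "(\<lambda>(a, b). (a @ b, length a)) ` (F \<times> G) \<subseteq> (SIGMA w:W. {..length w})"
      by (auto simp: W_def)
    fix q assume q: "q \<in> (SIGMA w:W. {..length w}) - (\<lambda>(a, b). (a @ b, length a)) ` (F \<times> G)"
    obtain w i where wi: "q = (w, i)" "w \<in> W" "i \<le> length w"
      using q by auto
    have "q = (\<lambda>(a, b). (a @ b, length a)) (take i w, drop i w)"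
      using wi by simp
    then have "take i w \<notin> F \<or> drop i w \<notin> G"
      using q by blast
    then show "t (take (snd q) (fst q)) (drop (snd q) (fst q)) = \<zero>\<^bsub>A\<^esub>"
      using t_zero lists_split wi W by simp
  qed (use fin W t lists_split in auto)
  also have "\<dots> = (\<Oplus>\<^bsub>A\<^esub>q\<in>F \<times> G. t (fst q) (snd q))"
    using t_FG by (subst S.finsum_reindex) (auto simp: inj_on_def case_prod_unfold)
  also have "\<dots> = (\<Oplus>\<^bsub>A\<^esub>a\<in>F. \<Oplus>\<^bsub>A\<^esub>b\<in>G. t a b)"
    using t_FG fin by (intro S.finsum_Sigma[symmetric]) auto
  also have "\<dots> = (\<Oplus>\<^bsub>A\<^esub>a\<in>F. (\<sigma> (f a) \<otimes>\<^bsub>A\<^esub> p a) \<otimes>\<^bsub>A\<^esub> (\<Oplus>\<^bsub>A\<^esub>b\<in>G. \<sigma> (g b) \<otimes>\<^bsub>A\<^esub> p b))"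
  proof (rule S.finsum_cong')
    fix a assume "a \<in> F"
    then show "(\<Oplus>\<^bsub>A\<^esub>b\<in>G. t a b) = (\<sigma> (f a) \<otimes>\<^bsub>A\<^esub> p a) \<otimes>\<^bsub>A\<^esub> (\<Oplus>\<^bsub>A\<^esub>b\<in>G. \<sigma> (g b) \<otimes>\<^bsub>A\<^esub> p b)"
      unfolding t_def using fin term_closed by (intro S.finsum_rdistr[symmetric]) auto
  qed (use term_closed in \<open>auto intro!: S.m_closed S.finsum_closed\<close>)
  also have "\<dots> = (\<Oplus>\<^bsub>A\<^esub>a\<in>F. \<sigma> (f a) \<otimes>\<^bsub>A\<^esub> p a) \<otimes>\<^bsub>A\<^esub> (\<Oplus>\<^bsub>A\<^esub>b\<in>G. \<sigma> (g b) \<otimes>\<^bsub>A\<^esub> p b)"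
    using fin term_closed by (intro S.finsum_ldistr[symmetric]) (auto intro!: S.finsum_closed)
  finally show ?thesis
    unfolding ncpoly_eval_def p_def F_def G_def fg_def .
qed

lemma ncpoly_eval_list_product:
  assumes "set fs \<subseteq> carrier (ncpoly_ring K r)" "v \<in> {1..r} \<rightarrow> carrier A"
  shows "ncpoly_eval K A \<sigma> (list_product (ncpoly_ring K r) fs) v =
    list_product A (map (\<lambda>f. ncpoly_eval K A \<sigma> f v) fs)"
  using assms by (induction fs) (auto simp: ncpoly_eval_one ncpoly_eval_mult R.ncpoly_list_product_closed)

end

section \<open>Endomorphism rings and centralizers\<close>

lemma (in ring) centralizer_subring:
  assumes "S \<subseteq> carrier R"
  shows "subring {c \<in> carrier R. \<forall>a\<in>S. c \<otimes> a = a \<otimes> c} R"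
proof (rule subringI)
  fix c d
  assume "c \<in> {c \<in> carrier R. \<forall>a\<in>S. c \<otimes> a = a \<otimes> c}" "d \<in> {c \<in> carrier R. \<forall>a\<in>S. c \<otimes> a = a \<otimes> c}"
  then have cd: "c \<in> carrier R" "d \<in> carrier R" "\<And>a. a \<in> S \<Longrightarrow> c \<otimes> a = a \<otimes> c" "\<And>a. a \<in> S \<Longrightarrow> d \<otimes> a = a \<otimes> d"
    by blast+
  have "c \<otimes> d \<otimes> a = a \<otimes> (c \<otimes> d)" if "a \<in> S" for a
  proof -
    have a: "a \<in> carrier R"
      using that assms by blast
    have "c \<otimes> d \<otimes> a = c \<otimes> (a \<otimes> d)"
      using cd(1,2) cd(4)[OF that] a by (simp add: m_assoc)
    also have "\<dots> = a \<otimes> c \<otimes> d"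
      using cd(1,2) cd(3)[OF that] a by (simp flip: m_assoc)
    finally show ?thesis
      using cd(1,2) a by (simp add: m_assoc)
  qed
  then show "c \<otimes> d \<in> {c \<in> carrier R. \<forall>a\<in>S. c \<otimes> a = a \<otimes> c}"
    using cd(1,2) by blast
qed (use assms in \<open>auto simp: l_minus r_minus l_distr r_distr subset_iff\<close>)

lemma (in ring) two_sided_annihilator_ideal:
  assumes "a \<in> carrier R"
  shows "ideal {c \<in> carrier R. c \<otimes> a = \<zero> \<and> a \<otimes> c = \<zero>} (R\<lparr>carrier := {c \<in> carrier R. c \<otimes> a = a \<otimes> c}\<rparr>)"
    (is "ideal ?I ?C")
proof -
  have "subring {c \<in> carrier R. c \<otimes> a = a \<otimes> c} R"
    using centralizer_subring[of "{a}"] assms by simp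
  then interpret C: ring ?C
    by (rule subring_is_ring)
  have a: "a \<in> carrier ?C"
    using assms by simp
  show ?thesis
  proof (rule idealI)
    show "ring ?C"
      by (rule C.ring_axioms)
    show "subgroup ?I (add_monoid ?C)"
    proof (rule C.add.subgroupI)
      fix c assume c: "c \<in> ?I"
      have "c \<in> carrier ?C"
        using c by simp
      then have "(\<ominus>\<^bsub>?C\<^esub> c) \<otimes>\<^bsub>?C\<^esub> a = \<zero>\<^bsub>?C\<^esub>" "a \<otimes>\<^bsub>?C\<^esub> (\<ominus>\<^bsub>?C\<^esub> c) = \<zero>\<^bsub>?C\<^esub>" "\<ominus>\<^bsub>?C\<^esub> c \<in> carrier ?C"
        using c a C.l_minus[of c a] C.r_minus[of a c] C.a_inv_closed[of c] C.minus_zero by auto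
      then show "\<ominus>\<^bsub>?C\<^esub> c \<in> ?I"
        by simp
        next
      have "\<zero> \<in> ?I"
        using assms by simp
      then show "?I \<noteq> {}"
        by blast
    qed (use assms in \<open>auto simp: l_distr r_distr\<close>)
  next
    fix c b assume "c \<in> ?I" "b \<in> carrier ?C"
    then have c: "c \<in> carrier R" "c \<otimes> a = \<zero>" "a \<otimes> c = \<zero>" and b: "b \<in> carrier R" "b \<otimes> a = a \<otimes> b"
      by auto
    have "b \<otimes> c \<otimes> a = \<zero>" "a \<otimes> (c \<otimes> b) = \<zero>"
      using assms c b by (simp_all add: m_assoc flip: m_assoc[of a c b])
    moreover have "a \<otimes> (b \<otimes> c) = b \<otimes> (a \<otimes> c)" "c \<otimes> b \<otimes> a = c \<otimes> a \<otimes> b"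
      using assms c(1) b by (metis m_assoc)+
    ultimately show "b \<otimes>\<^bsub>?C\<^esub> c \<in> ?I" "c \<otimes>\<^bsub>?C\<^esub> b \<in> ?I"
      using assms c b by simp_all
  qed
qed

lemma (in ring) center_is_ring: "ring (center_ring R)"
  unfolding center_ring_def using centralizer_subring[of "carrier R"] by (intro subring_is_ring) simp

lemma center_ring_ops [simp]:
  "a \<otimes>\<^bsub>center_ring R\<^esub> b = a \<otimes>\<^bsub>R\<^esub> b" "a \<oplus>\<^bsub>center_ring R\<^esub> b = a \<oplus>\<^bsub>R\<^esub> b"
  "\<one>\<^bsub>center_ring R\<^esub> = \<one>\<^bsub>R\<^esub>" "\<zero>\<^bsub>center_ring R\<^esub> = \<zero>\<^bsub>R\<^esub>"
  by (simp_all add: center_ring_def)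

lemma center_ring_memD: "c \<in> carrier (center_ring R) \<Longrightarrow> c \<in> carrier R"
  by (simp add: center_ring_def)

locale left_mod =
  fixes R :: "('a, 'b) ring_scheme" and M :: "('a, 'm, 'c) module_scheme"
  assumes left_module: "left_module R M"
begin

sublocale R: ring R
  using left_module by (simp add: left_module_def)

sublocale M: abelian_group M
  using left_module by (simp add: left_module_def)

lemma smult_closed [simp, intro]: "a \<in> carrier R \<Longrightarrow> y \<in> carrier M \<Longrightarrow> a \<odot>\<^bsub>M\<^esub> y \<in> carrier M"
  and smult_l_distr: "a \<in> carrier R \<Longrightarrow> b \<in> carrier R \<Longrightarrow> y \<in> carrier M \<Longrightarrow>
    (a \<oplus>\<^bsub>R\<^esub> b) \<odot>\<^bsub>M\<^esub> y = a \<odot>\<^bsub>M\<^esub> y \<oplus>\<^bsub>M\<^esub> b \<odot>\<^bsub>M\<^esub> y"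
  and smult_r_distr: "a \<in> carrier R \<Longrightarrow> y \<in> carrier M \<Longrightarrow> z \<in> carrier M \<Longrightarrow>
    a \<odot>\<^bsub>M\<^esub> (y \<oplus>\<^bsub>M\<^esub> z) = a \<odot>\<^bsub>M\<^esub> y \<oplus>\<^bsub>M\<^esub> a \<odot>\<^bsub>M\<^esub> z"
  and smult_assoc: "a \<in> carrier R \<Longrightarrow> b \<in> carrier R \<Longrightarrow> y \<in> carrier M \<Longrightarrow>
    (a \<otimes>\<^bsub>R\<^esub> b) \<odot>\<^bsub>M\<^esub> y = a \<odot>\<^bsub>M\<^esub> (b \<odot>\<^bsub>M\<^esub> y)"
  and smult_one [simp]: "y \<in> carrier M \<Longrightarrow> \<one>\<^bsub>R\<^esub> \<odot>\<^bsub>M\<^esub> y = y"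
  using left_module by (simp_all add: left_module_def)

lemma smult_l_zero [simp]: "y \<in> carrier M \<Longrightarrow> \<zero>\<^bsub>R\<^esub> \<odot>\<^bsub>M\<^esub> y = \<zero>\<^bsub>M\<^esub>"
  using smult_l_distr[of "\<zero>\<^bsub>R\<^esub>" "\<zero>\<^bsub>R\<^esub>" y] M.add.r_cancel_one'[of "\<zero>\<^bsub>R\<^esub> \<odot>\<^bsub>M\<^esub> y" "\<zero>\<^bsub>R\<^esub> \<odot>\<^bsub>M\<^esub> y"] by simp

lemma smult_r_zero [simp]: "a \<in> carrier R \<Longrightarrow> a \<odot>\<^bsub>M\<^esub> \<zero>\<^bsub>M\<^esub> = \<zero>\<^bsub>M\<^esub>"
  using smult_r_distr[of a "\<zero>\<^bsub>M\<^esub>" "\<zero>\<^bsub>M\<^esub>"] M.add.r_cancel_one'[of "a \<odot>\<^bsub>M\<^esub> \<zero>\<^bsub>M\<^esub>" "a \<odot>\<^bsub>M\<^esub> \<zero>\<^bsub>M\<^esub>"] by simp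

lemma smult_finsum:
  "a \<in> carrier R \<Longrightarrow> g \<in> A \<rightarrow> carrier M \<Longrightarrow> a \<odot>\<^bsub>M\<^esub> finsum M g A = (\<Oplus>\<^bsub>M\<^esub>i\<in>A. a \<odot>\<^bsub>M\<^esub> g i)"
  by (rule additive_finsum) (auto simp: M.abelian_group_axioms smult_r_distr)

lemma finsum_smult:
  "c \<in> A \<rightarrow> carrier R \<Longrightarrow> y \<in> carrier M \<Longrightarrow> finsum R c A \<odot>\<^bsub>M\<^esub> y = (\<Oplus>\<^bsub>M\<^esub>i\<in>A. c i \<odot>\<^bsub>M\<^esub> y)"
  by (rule additive_finsum[where h = "\<lambda>a. a \<odot>\<^bsub>M\<^esub> y"])
    (auto simp: R.abelian_group_axioms M.abelian_group_axioms smult_l_distr)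

lemma submoduleI:
  assumes "H \<subseteq> carrier M" "\<zero>\<^bsub>M\<^esub> \<in> H"
    and "\<And>y z. y \<in> H \<Longrightarrow> z \<in> H \<Longrightarrow> y \<oplus>\<^bsub>M\<^esub> z \<in> H"
    and smult: "\<And>a y. a \<in> carrier R \<Longrightarrow> y \<in> H \<Longrightarrow> a \<odot>\<^bsub>M\<^esub> y \<in> H"
  shows "submodule H R M"
proof -
  have "\<ominus>\<^bsub>M\<^esub> y \<in> H" if "y \<in> H" for y
  proof -
    have y: "y \<in> carrier M"
      using that assms by auto
    have "(\<ominus>\<^bsub>R\<^esub> \<one>\<^bsub>R\<^esub>) \<odot>\<^bsub>M\<^esub> y \<oplus>\<^bsub>M\<^esub> y = (\<ominus>\<^bsub>R\<^esub> \<one>\<^bsub>R\<^esub> \<oplus>\<^bsub>R\<^esub> \<one>\<^bsub>R\<^esub>) \<odot>\<^bsub>M\<^esub> y"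
      using y by (simp add: smult_l_distr del: R.l_neg)
    then have "\<ominus>\<^bsub>M\<^esub> y = (\<ominus>\<^bsub>R\<^esub> \<one>\<^bsub>R\<^esub>) \<odot>\<^bsub>M\<^esub> y"
      using y by (intro M.minus_equality) (simp_all add: R.l_neg)
    then show ?thesis
      using smult that by simp
  qed
  then show ?thesis
    using assms M.add.subgroupI[of H]
    by (intro submodule.intro submodule_axioms.intro) (auto simp: a_inv_def)
qed

lemma End_ring_iff:
  "\<psi> \<in> carrier (End_ring R M) \<longleftrightarrow> \<psi> \<in> carrier M \<rightarrow>\<^sub>E carrier M \<and>
    (\<forall>x\<in>carrier M. \<forall>y\<in>carrier M. \<psi> (x \<oplus>\<^bsub>M\<^esub> y) = \<psi> x \<oplus>\<^bsub>M\<^esub> \<psi> y) \<and>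
    (\<forall>a\<in>carrier R. \<forall>x\<in>carrier M. \<psi> (a \<odot>\<^bsub>M\<^esub> x) = a \<odot>\<^bsub>M\<^esub> \<psi> x)"
  by (simp add: End_ring_def)

lemma End_closed [simp]: "\<psi> \<in> carrier (End_ring R M) \<Longrightarrow> y \<in> carrier M \<Longrightarrow> \<psi> y \<in> carrier M"
  and End_add: "\<psi> \<in> carrier (End_ring R M) \<Longrightarrow> y \<in> carrier M \<Longrightarrow> z \<in> carrier M \<Longrightarrow>
    \<psi> (y \<oplus>\<^bsub>M\<^esub> z) = \<psi> y \<oplus>\<^bsub>M\<^esub> \<psi> z"
  and End_smult: "\<psi> \<in> carrier (End_ring R M) \<Longrightarrow> a \<in> carrier R \<Longrightarrow> y \<in> carrier M \<Longrightarrow>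
    \<psi> (a \<odot>\<^bsub>M\<^esub> y) = a \<odot>\<^bsub>M\<^esub> \<psi> y"
  by (auto simp: End_ring_iff)

lemma End_zero [simp]: "\<psi> \<in> carrier (End_ring R M) \<Longrightarrow> \<psi> \<zero>\<^bsub>M\<^esub> = \<zero>\<^bsub>M\<^esub>"
  using End_smult[of \<psi> "\<zero>\<^bsub>R\<^esub>" "\<zero>\<^bsub>M\<^esub>"] by simp

lemma End_finsum:
  "\<psi> \<in> carrier (End_ring R M) \<Longrightarrow> g \<in> A \<rightarrow> carrier M \<Longrightarrow> \<psi> (finsum M g A) = (\<Oplus>\<^bsub>M\<^esub>i\<in>A. \<psi> (g i))"
  by (rule additive_finsum) (auto simp: M.abelian_group_axioms End_add)

lemma End_eqI:
  assumes "\<psi> \<in> carrier (End_ring R M)" "\<theta> \<in> carrier (End_ring R M)"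
    and "\<And>y. y \<in> carrier M \<Longrightarrow> \<psi> y = \<theta> y"
  shows "\<psi> = \<theta>"
  using assms by (intro extensionalityI[of _ "carrier M"]) (auto simp: End_ring_iff PiE_def)

lemma End_apply [simp]:
  assumes "y \<in> carrier M"
  shows "(\<psi> \<otimes>\<^bsub>End_ring R M\<^esub> \<theta>) y = \<psi> (\<theta> y)"
    and "(\<psi> \<oplus>\<^bsub>End_ring R M\<^esub> \<theta>) y = \<psi> y \<oplus>\<^bsub>M\<^esub> \<theta> y"
    and "\<one>\<^bsub>End_ring R M\<^esub> y = y"
    and "\<zero>\<^bsub>End_ring R M\<^esub> y = \<zero>\<^bsub>M\<^esub>"
  using assms by (simp_all add: End_ring_def compose_def)

lemma End_ops_closed:
  assumes "\<psi> \<in> carrier (End_ring R M)" "\<theta> \<in> carrier (End_ring R M)"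
  shows "\<psi> \<otimes>\<^bsub>End_ring R M\<^esub> \<theta> \<in> carrier (End_ring R M)"
    and "\<psi> \<oplus>\<^bsub>End_ring R M\<^esub> \<theta> \<in> carrier (End_ring R M)"
proof -
  have "\<psi> \<otimes>\<^bsub>End_ring R M\<^esub> \<theta> = (\<lambda>y\<in>carrier M. \<psi> (\<theta> y))" "\<psi> \<oplus>\<^bsub>End_ring R M\<^esub> \<theta> = (\<lambda>y\<in>carrier M. \<psi> y \<oplus>\<^bsub>M\<^esub> \<theta> y)"
    by (simp_all add: End_ring_def compose_def)
  then show "\<psi> \<otimes>\<^bsub>End_ring R M\<^esub> \<theta> \<in> carrier (End_ring R M)" "\<psi> \<oplus>\<^bsub>End_ring R M\<^esub> \<theta> \<in> carrier (End_ring R M)"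
    using assms End_closed[OF assms(1)] End_closed[OF assms(2)]
    unfolding End_ring_iff
    by (auto simp: End_add End_smult smult_r_distr M.a_ac)
qed

lemma End_scalar_closed:
  assumes "c \<in> carrier (center_ring R)"
  shows "(\<lambda>y\<in>carrier M. c \<odot>\<^bsub>M\<^esub> y) \<in> carrier (End_ring R M)"
  using assms by (auto simp: End_ring_iff center_ring_def smult_r_distr simp flip: smult_assoc)

lemma End_unit_closed:
  "\<one>\<^bsub>End_ring R M\<^esub> \<in> carrier (End_ring R M)" "\<zero>\<^bsub>End_ring R M\<^esub> \<in> carrier (End_ring R M)"
  unfolding End_ring_iff by (auto simp: End_ring_def)

lemma End_neg:
  assumes "\<psi> \<in> carrier (End_ring R M)"
  shows "(\<lambda>y\<in>carrier M. \<psi> (\<ominus>\<^bsub>M\<^esub> y)) \<in> carrier (End_ring R M)"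
    and "(\<lambda>y\<in>carrier M. \<psi> (\<ominus>\<^bsub>M\<^esub> y)) \<oplus>\<^bsub>End_ring R M\<^esub> \<psi> = \<zero>\<^bsub>End_ring R M\<^esub>"
proof -
  have "(\<ominus>\<^bsub>M\<^esub> (a \<odot>\<^bsub>M\<^esub> y)) = a \<odot>\<^bsub>M\<^esub> (\<ominus>\<^bsub>M\<^esub> y)" if "a \<in> carrier R" "y \<in> carrier M" for a y
    using that smult_r_distr[of a "\<ominus>\<^bsub>M\<^esub> y" y] by (intro M.minus_equality) (simp_all add: M.l_neg)
  then show *: "(\<lambda>y\<in>carrier M. \<psi> (\<ominus>\<^bsub>M\<^esub> y)) \<in> carrier (End_ring R M)"
    using assms End_closed[OF assms] unfolding End_ring_iff
    by (auto simp: M.minus_add)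
  show "(\<lambda>y\<in>carrier M. \<psi> (\<ominus>\<^bsub>M\<^esub> y)) \<oplus>\<^bsub>End_ring R M\<^esub> \<psi> = \<zero>\<^bsub>End_ring R M\<^esub>"
    using * assms
    by (intro End_eqI End_ops_closed End_unit_closed) (simp_all add: M.l_neg flip: End_add)
qed

sublocale E: ring "End_ring R M"
proof (rule ringI)
  show "abelian_group (End_ring R M)"
  proof (rule abelian_groupI)
    fix \<psi> assume "\<psi> \<in> carrier (End_ring R M)"
    then show "\<exists>\<theta>\<in>carrier (End_ring R M). \<theta> \<oplus>\<^bsub>End_ring R M\<^esub> \<psi> = \<zero>\<^bsub>End_ring R M\<^esub>"
      using End_neg by blast
  qed (auto intro!: End_eqI End_ops_closed End_unit_closed simp: M.a_ac)
  show "monoid (End_ring R M)"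
    by (rule monoidI) (auto intro!: End_eqI End_ops_closed End_unit_closed)
qed (auto intro!: End_eqI End_ops_closed End_unit_closed simp: End_add)

end

locale module_endomorphism = left_mod R M
  for R :: "('a, 'b) ring_scheme" and M :: "('a, 'm, 'c) module_scheme" +
  fixes \<phi> :: "'m \<Rightarrow> 'm"
  assumes endo: "\<phi> \<in> carrier (End_ring R M)"
begin

lemma Cen_iff: "\<psi> \<in> carrier (Cen R M \<phi>) \<longleftrightarrow>
    \<psi> \<in> carrier (End_ring R M) \<and> (\<forall>y\<in>carrier M. \<psi> (\<phi> y) = \<phi> (\<psi> y))"
proof -
  have "\<psi> \<otimes>\<^bsub>End_ring R M\<^esub> \<phi> = \<phi> \<otimes>\<^bsub>End_ring R M\<^esub> \<psi> \<longleftrightarrow> (\<forall>y\<in>carrier M. \<psi> (\<phi> y) = \<phi> (\<psi> y))"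
    if "\<psi> \<in> carrier (End_ring R M)"
  proof
    show "\<forall>y\<in>carrier M. \<psi> (\<phi> y) = \<phi> (\<psi> y)"
      if eq: "\<psi> \<otimes>\<^bsub>End_ring R M\<^esub> \<phi> = \<phi> \<otimes>\<^bsub>End_ring R M\<^esub> \<psi>"
    proof
      fix y assume "y \<in> carrier M"
      then show "\<psi> (\<phi> y) = \<phi> (\<psi> y)"
        using fun_cong[OF eq, of y] by simp
    qed
  qed (use that endo in \<open>intro End_eqI End_ops_closed; simp\<close>)
  then show ?thesis
    by (auto simp: Cen_def)
qed

lemma Cen_ops [simp]:
  "\<psi> \<otimes>\<^bsub>Cen R M \<phi>\<^esub> \<theta> = \<psi> \<otimes>\<^bsub>End_ring R M\<^esub> \<theta>" "\<psi> \<oplus>\<^bsub>Cen R M \<phi>\<^esub> \<theta> = \<psi> \<oplus>\<^bsub>End_ring R M\<^esub> \<theta>"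
  "\<one>\<^bsub>Cen R M \<phi>\<^esub> = \<one>\<^bsub>End_ring R M\<^esub>" "\<zero>\<^bsub>Cen R M \<phi>\<^esub> = \<zero>\<^bsub>End_ring R M\<^esub>"
  by (simp_all add: Cen_def)

sublocale Cen: ring "Cen R M \<phi>"
  unfolding Cen_def using E.centralizer_subring[of "{\<phi>}"] endo
  by (intro E.subring_is_ring) simp

sublocale Cen0: ideal "Cen0 R M \<phi>" "Cen R M \<phi>"
  unfolding Cen_def Cen0_def using endo by (rule E.two_sided_annihilator_ideal)

text \<open>Multiplication by \<open>c\<close> is \<open>R\<close>-linear as \<open>c\<close> is central in \<open>R\<close>, and it commutes with all
  endomorphisms by their linearity.\<close>

lemma Cen_scalar_algebra:
  "central_algebra (center_ring R) (Cen R M \<phi>) (\<lambda>c. \<lambda>y\<in>carrier M. c \<odot>\<^bsub>M\<^esub> y)"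
proof -
  have closed: "(\<lambda>y\<in>carrier M. c \<odot>\<^bsub>M\<^esub> y) \<in> carrier (Cen R M \<phi>)" if "c \<in> carrier (center_ring R)" for c
    using End_scalar_closed[OF that] center_ring_memD[OF that] endo
    by (intro Cen_iff[THEN iffD2] conjI ballI) (simp_all add: End_smult)
  have "ring_hom_ring (center_ring R) (Cen R M \<phi>) (\<lambda>c. \<lambda>y\<in>carrier M. c \<odot>\<^bsub>M\<^esub> y)"
  proof (rule ring_hom_ringI)
    fix c d assume c: "c \<in> carrier (center_ring R)" and d: "d \<in> carrier (center_ring R)"
    interpret Z: ring "center_ring R"
      by (rule R.center_is_ring)
    have R: "c \<in> carrier R" "d \<in> carrier R"
      using c d by (simp_all add: center_ring_memD)
    show "(\<lambda>y\<in>carrier M. (c \<otimes>\<^bsub>center_ring R\<^esub> d) \<odot>\<^bsub>M\<^esub> y) =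
        (\<lambda>y\<in>carrier M. c \<odot>\<^bsub>M\<^esub> y) \<otimes>\<^bsub>Cen R M \<phi>\<^esub> (\<lambda>y\<in>carrier M. d \<odot>\<^bsub>M\<^esub> y)"
      using Z.m_closed[OF c d] End_scalar_closed[OF c] End_scalar_closed[OF d] R c d unfolding Cen_ops
      by (intro End_eqI End_scalar_closed End_ops_closed) (simp_all add: smult_assoc)
    show "(\<lambda>y\<in>carrier M. (c \<oplus>\<^bsub>center_ring R\<^esub> d) \<odot>\<^bsub>M\<^esub> y) =
        (\<lambda>y\<in>carrier M. c \<odot>\<^bsub>M\<^esub> y) \<oplus>\<^bsub>Cen R M \<phi>\<^esub> (\<lambda>y\<in>carrier M. d \<odot>\<^bsub>M\<^esub> y)"
      using Z.a_closed[OF c d] End_scalar_closed[OF c] End_scalar_closed[OF d] R c d unfolding Cen_ops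
      by (intro End_eqI End_scalar_closed End_ops_closed) (simp_all add: smult_l_distr)
  next
    show "(\<lambda>y\<in>carrier M. \<one>\<^bsub>center_ring R\<^esub> \<odot>\<^bsub>M\<^esub> y) = \<one>\<^bsub>Cen R M \<phi>\<^esub>"
      by (auto simp: End_ring_def Cen_def)
  qed (use closed R.center_is_ring Cen.ring_axioms in simp_all)
  then show ?thesis
  proof (rule central_algebra.intro, unfold_locales)
    fix c \<psi> assume c: "c \<in> carrier (center_ring R)" and \<psi>: "\<psi> \<in> carrier (Cen R M \<phi>)"
    then have *: "c \<in> carrier R" "\<psi> \<in> carrier (End_ring R M)"
      by (simp_all add: center_ring_memD Cen_iff)
    show "(\<lambda>y\<in>carrier M. c \<odot>\<^bsub>M\<^esub> y) \<otimes>\<^bsub>Cen R M \<phi>\<^esub> \<psi> = \<psi> \<otimes>\<^bsub>Cen R M \<phi>\<^esub> (\<lambda>y\<in>carrier M. c \<odot>\<^bsub>M\<^esub> y)"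
      using * End_scalar_closed[OF c] unfolding Cen_ops
      by (intro End_eqI End_ops_closed) (simp_all add: End_smult)
  qed
qed

end

section \<open>Simple modules over a local ring\<close>

lemma (in ring) left_idealI:
  assumes "I \<subseteq> carrier R" "\<zero> \<in> I"
    and "\<And>a b. a \<in> I \<Longrightarrow> b \<in> I \<Longrightarrow> a \<oplus> b \<in> I"
    and mult: "\<And>a b. a \<in> carrier R \<Longrightarrow> b \<in> I \<Longrightarrow> a \<otimes> b \<in> I"
  shows "left_ideal R I"
proof -
  have "\<ominus> a \<in> I" if "a \<in> I" for a
    using mult[of "\<ominus> \<one>" a] that assms(1) by (auto simp: l_minus)
  then have "additive_subgroup I R"
    using assms by (intro additive_subgroupI add.subgroupI) (auto simp: a_inv_def)
  then show ?thesis
    using mult by (simp add: left_ideal_def)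
qed

lemma (in ring) left_idealD:
  assumes "left_ideal R I"
  shows "I \<subseteq> carrier R" "\<zero> \<in> I" "\<And>a b. a \<in> I \<Longrightarrow> b \<in> I \<Longrightarrow> a \<oplus> b \<in> I"
    "\<And>a. a \<in> I \<Longrightarrow> \<ominus> a \<in> I" "\<And>a b. a \<in> carrier R \<Longrightarrow> b \<in> I \<Longrightarrow> a \<otimes> b \<in> I"
    "\<one> \<in> I \<Longrightarrow> I = carrier R"
proof -
  interpret additive_subgroup I R
    using assms by (simp add: left_ideal_def)
  show "I \<subseteq> carrier R" "\<zero> \<in> I" "\<And>a b. a \<in> I \<Longrightarrow> b \<in> I \<Longrightarrow> a \<oplus> b \<in> I" "\<And>a. a \<in> I \<Longrightarrow> \<ominus> a \<in> I"
    using a_subset by auto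
  show mult: "\<And>a b. a \<in> carrier R \<Longrightarrow> b \<in> I \<Longrightarrow> a \<otimes> b \<in> I"
    using assms by (simp add: left_ideal_def)
  show "I = carrier R" if "\<one> \<in> I"
    using mult[OF _ that] a_subset by auto
qed

text \<open>This is the annihilator of the class of \<open>b\<close> in the simple module \<open>R/I\<close>.\<close>

lemma (in ring) maximal_left_ideal_colon:
  assumes I: "maximal_left_ideal R I" and b: "b \<in> carrier R" "b \<notin> I"
  shows "maximal_left_ideal R {c \<in> carrier R. c \<otimes> b \<in> I}" (is "maximal_left_ideal R ?L")
proof -
  have "left_ideal R I"
    using I by (simp add: maximal_left_ideal_def)
  note ID = left_idealD[OF this]
  have left: "left_ideal R ?L"
    using b ID by (intro left_idealI) (auto simp: l_distr m_assoc)
  have "\<one> \<notin> ?L"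
    using b by simp
  then have "?L \<noteq> carrier R"
    by blast
  moreover have "L = carrier R" if L: "left_ideal R L" "?L \<subseteq> L" "L \<noteq> ?L" for L
  proof -
    note LD = left_idealD[OF L(1)]
    obtain c where c: "c \<in> L" "c \<in> carrier R" "c \<otimes> b \<notin> I"
      using L LD(1) by blast
    \<comment> \<open>By maximality of \<open>I\<close>, the left ideal \<open>I + Rcb\<close> contains \<open>b\<close>; solving for \<open>b\<close> puts \<open>1 - dc\<close> into \<open>L\<close>.\<close>
    define N where "N = {i \<oplus> d \<otimes> (c \<otimes> b) | i d. i \<in> I \<and> d \<in> carrier R}"
    have N: "i \<oplus> d \<otimes> (c \<otimes> b) \<in> N" if "i \<in> I" "d \<in> carrier R" for i d
      using that by (auto simp: N_def)
    have cb: "c \<otimes> b \<in> carrier R"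
      using c b by simp
    have "left_ideal R N"
    proof (rule left_idealI)
      show "N \<subseteq> carrier R"
        using ID(1) cb by (auto simp: N_def)
      show "\<zero> \<in> N"
        using N[of \<zero> \<zero>] ID(2) cb by simp
      fix u assume "u \<in> N"
      then obtain i d where u: "u = i \<oplus> d \<otimes> (c \<otimes> b)" "i \<in> I" "d \<in> carrier R"
        by (auto simp: N_def)
      have i: "i \<in> carrier R"
        using u ID(1) by auto
      show "u \<oplus> w \<in> N" if w: "w \<in> N" for w
      proof -
        obtain j e where w: "w = j \<oplus> e \<otimes> (c \<otimes> b)" "j \<in> I" "e \<in> carrier R"
          using w by (auto simp: N_def)
        have j: "j \<in> carrier R"
          using w ID(1) by auto
        have "u \<oplus> w = (i \<oplus> j) \<oplus> (d \<oplus> e) \<otimes> (c \<otimes> b)"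
          using u w i j cb by (simp add: l_distr a_ac)
        then show ?thesis
          using N u w ID(3) by simp
      qed
      show "a \<otimes> u \<in> N" if a: "a \<in> carrier R" for a
      proof -
        have "a \<otimes> u = a \<otimes> i \<oplus> (a \<otimes> d) \<otimes> (c \<otimes> b)"
          using u a i cb by (simp add: r_distr m_assoc)
        then show ?thesis
          using N u a ID(5) by simp
      qed
    qed
    moreover have "I \<subseteq> N"
    proof
      fix i assume i: "i \<in> I"
      have "i \<in> carrier R"
        using i ID(1) by auto
      then show "i \<in> N"
        using N[of i \<zero>] i cb by simp
    qed
    moreover have "c \<otimes> b \<in> N"
      using N[of \<zero> \<one>] ID(2) cb by simp
    ultimately have "N = carrier R"
      using I c unfolding maximal_left_ideal_def by blast
    then have "b \<in> N"
      using b by simp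
    then obtain i d where id: "b = i \<oplus> d \<otimes> (c \<otimes> b)" "i \<in> I" "d \<in> carrier R"
      unfolding N_def by blast
    have i: "i \<in> carrier R"
      using id ID(1) by auto
    have "(\<one> \<oplus> \<ominus> (d \<otimes> c)) \<otimes> b = b \<oplus> \<ominus> (d \<otimes> (c \<otimes> b))"
      using id(3) c b by (simp add: l_distr l_minus m_assoc)
    also have "\<dots> = i \<oplus> d \<otimes> (c \<otimes> b) \<oplus> \<ominus> (d \<otimes> (c \<otimes> b))"
      by (subst id(1)[symmetric]) (rule refl)
    also have "\<dots> = i"
      using i id(3) cb by (simp add: a_assoc r_neg)
    finally have "\<one> \<oplus> \<ominus> (d \<otimes> c) \<in> ?L"
      using id c by simp
    then have "(\<one> \<oplus> \<ominus> (d \<otimes> c)) \<oplus> d \<otimes> c \<in> L"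
      using L(2) LD(3,5) id c by blast
    then have "\<one> \<in> L"
      using id c by (simp add: a_assoc l_neg)
    then show ?thesis
      by (rule LD(6))
  qed
  ultimately show ?thesis
    using left unfolding maximal_left_ideal_def by blast
qed

text \<open>Closure under multiplication from the right is the nontrivial part: for \<open>a \<in> J\<close> and a maximal
  left ideal \<open>I\<close> not containing \<open>b\<close>, the element \<open>a\<close> lies in the maximal left ideal of all \<open>c\<close> with \<open>cb \<in> I\<close>.\<close>

lemma (in ring) jacobson_radical_ideal: "ideal (jacobson_radical R) R"
proof (rule idealI)
  have left: "left_ideal R I" if "maximal_left_ideal R I" for I
    using that by (simp add: maximal_left_ideal_def)
  have "left_ideal R (jacobson_radical R)"
    using left_idealD[OF left] by (intro left_idealI) (auto simp: jacobson_radical_def)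
  then show "subgroup (jacobson_radical R) (add_monoid R)"
    and "\<And>a b. a \<in> jacobson_radical R \<Longrightarrow> b \<in> carrier R \<Longrightarrow> b \<otimes> a \<in> jacobson_radical R"
    by (simp_all add: left_ideal_def additive_subgroup_def)
  fix a b assume a: "a \<in> jacobson_radical R" and b: "b \<in> carrier R"
  have "a \<otimes> b \<in> I" if I: "maximal_left_ideal R I" for I
  proof (cases "b \<in> I")
    case True
    then show ?thesis
      using a left_idealD[OF left[OF I]] by (auto simp: jacobson_radical_def)
  next
    case False
    then show ?thesis
      using a maximal_left_ideal_colon[OF I b] by (auto simp: jacobson_radical_def)
  qed
  then show "a \<otimes> b \<in> jacobson_radical R"
    using a b by (auto simp: jacobson_radical_def)
qed (rule ring_axioms)

lemma (in left_mod) simple_cyclic_nonzero: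
  assumes "simple_submodule R M (cyclic_submodule R M y)"
  shows "y \<noteq> \<zero>\<^bsub>M\<^esub>"
proof
  assume "y = \<zero>\<^bsub>M\<^esub>"
  then have "cyclic_submodule R M y = {\<zero>\<^bsub>M\<^esub>}"
    using R.zero_closed unfolding cyclic_submodule_def by force
  then show False
    using assms by (simp add: simple_submodule_def)
qed

text \<open>A left ideal \<open>L\<close> above the annihilator gives the submodule \<open>Ly\<close> of the simple module \<open>Ry\<close>. If
  \<open>Ly = Ry\<close>, then \<open>y = cy\<close> for some \<open>c \<in> L\<close>, and \<open>1 - c\<close> annihilates \<open>y\<close>.\<close>

lemma (in left_mod) annihilator_maximal:
  assumes y: "y \<in> carrier M" and simple: "simple_submodule R M (cyclic_submodule R M y)"
  shows "maximal_left_ideal R {a \<in> carrier R. a \<odot>\<^bsub>M\<^esub> y = \<zero>\<^bsub>M\<^esub>}" (is "maximal_left_ideal R ?A")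
proof -
  have "left_ideal R ?A"
    using y by (intro R.left_idealI) (auto simp: smult_l_distr smult_assoc)
  moreover have "y \<noteq> \<zero>\<^bsub>M\<^esub>"
    using simple by (rule simple_cyclic_nonzero)
  then have "\<one>\<^bsub>R\<^esub> \<notin> ?A"
    using y by simp
  then have "?A \<noteq> carrier R"
    by blast
  moreover have "L = ?A \<or> L = carrier R" if L: "left_ideal R L" "?A \<subseteq> L" for L
  proof -
    note LD = R.left_idealD[OF L(1)]
    define N where "N = (\<lambda>a. a \<odot>\<^bsub>M\<^esub> y) ` L"
    have "submodule N R M"
    proof (rule submoduleI)
      show "N \<subseteq> carrier M"
        using LD(1) y by (auto simp: N_def)
      show "\<zero>\<^bsub>M\<^esub> \<in> N"
        unfolding N_def using LD(2) y by (intro image_eqI[of _ _ "\<zero>\<^bsub>R\<^esub>"]) simp_all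
      fix u assume "u \<in> N"
      then obtain a where u: "u = a \<odot>\<^bsub>M\<^esub> y" "a \<in> L" "a \<in> carrier R"
        using LD(1) by (auto simp: N_def)
      show "u \<oplus>\<^bsub>M\<^esub> w \<in> N" if wN: "w \<in> N" for w
      proof -
        obtain b where w: "w = b \<odot>\<^bsub>M\<^esub> y" "b \<in> L" "b \<in> carrier R"
          using LD(1) wN by (auto simp: N_def)
        show ?thesis
          unfolding N_def using LD(3) u w y
          by (intro image_eqI[of _ _ "a \<oplus>\<^bsub>R\<^esub> b"]) (simp_all add: smult_l_distr)
      qed
      show "b \<odot>\<^bsub>M\<^esub> u \<in> N" if "b \<in> carrier R" for b
        unfolding N_def using LD(5) u that y
        by (intro image_eqI[of _ _ "b \<otimes>\<^bsub>R\<^esub> a"]) (simp_all add: smult_assoc)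
    qed
    moreover have "N \<subseteq> cyclic_submodule R M y"
      using LD(1) by (auto simp: N_def cyclic_submodule_def)
    ultimately consider "N = {\<zero>\<^bsub>M\<^esub>}" | "N = cyclic_submodule R M y"
      using simple by (auto simp: simple_submodule_def)
    then show ?thesis
    proof cases
      case 1
      then have "L \<subseteq> ?A"
        using LD(1) by (auto simp: N_def)
      then show ?thesis
        using L by blast
    next
      case 2
      have "y \<in> cyclic_submodule R M y"
        using y by (auto simp: cyclic_submodule_def intro!: exI[of _ "\<one>\<^bsub>R\<^esub>"])
      then obtain c where c: "y = c \<odot>\<^bsub>M\<^esub> y" "c \<in> L" "c \<in> carrier R"
        using 2 LD(1) by (auto simp: N_def)
      have "(\<one>\<^bsub>R\<^esub> \<oplus>\<^bsub>R\<^esub> \<ominus>\<^bsub>R\<^esub> c) \<odot>\<^bsub>M\<^esub> y = \<one>\<^bsub>R\<^esub> \<odot>\<^bsub>M\<^esub> y \<oplus>\<^bsub>M\<^esub> (\<ominus>\<^bsub>R\<^esub> c) \<odot>\<^bsub>M\<^esub> y"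
        using c y by (intro smult_l_distr) auto
      also have "\<one>\<^bsub>R\<^esub> \<odot>\<^bsub>M\<^esub> y = c \<odot>\<^bsub>M\<^esub> y"
        using c y by simp
      also have "c \<odot>\<^bsub>M\<^esub> y \<oplus>\<^bsub>M\<^esub> (\<ominus>\<^bsub>R\<^esub> c) \<odot>\<^bsub>M\<^esub> y = \<zero>\<^bsub>M\<^esub>"
        using c(3) y smult_l_distr[of c "\<ominus>\<^bsub>R\<^esub> c" y] by (simp add: R.r_neg)
      finally have "\<one>\<^bsub>R\<^esub> \<oplus>\<^bsub>R\<^esub> \<ominus>\<^bsub>R\<^esub> c \<in> ?A"
        using c by simp
      then have "(\<one>\<^bsub>R\<^esub> \<oplus>\<^bsub>R\<^esub> \<ominus>\<^bsub>R\<^esub> c) \<oplus>\<^bsub>R\<^esub> c \<in> L"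
        using L LD(3) c by blast
      then have "\<one>\<^bsub>R\<^esub> \<in> L"
        using c by (simp add: R.a_assoc R.l_neg)
      then show ?thesis
        using LD(6) by blast
    qed
  qed
  ultimately show ?thesis
    by (simp add: maximal_left_ideal_def)
qed

text \<open>The annihilator of \<open>y\<close> is a maximal left ideal, so it contains \<open>J\<close>; and it contains nothing
  else, since an element outside \<open>J\<close> has a left inverse modulo \<open>J\<close>, whereas \<open>J\<close> and the element would both
  kill \<open>y\<close>.\<close>

lemma (in left_mod) annihilator_simple_local:
  assumes "is_local_ring R" and y: "y \<in> carrier M"
    and simple: "simple_submodule R M (cyclic_submodule R M y)" and a: "a \<in> carrier R"
  shows "a \<odot>\<^bsub>M\<^esub> y = \<zero>\<^bsub>M\<^esub> \<longleftrightarrow> a \<in> jacobson_radical R"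
proof
  let ?J = "jacobson_radical R" and ?A = "{a \<in> carrier R. a \<odot>\<^bsub>M\<^esub> y = \<zero>\<^bsub>M\<^esub>}"
  interpret J: ideal ?J R
    by (rule R.jacobson_radical_ideal)
  have "?J \<subseteq> ?A"
    using annihilator_maximal[OF y simple] unfolding jacobson_radical_def by blast
  then show "a \<in> ?J \<Longrightarrow> a \<odot>\<^bsub>M\<^esub> y = \<zero>\<^bsub>M\<^esub>"
    by blast
  show "a \<in> ?J" if ay: "a \<odot>\<^bsub>M\<^esub> y = \<zero>\<^bsub>M\<^esub>"
  proof (rule ccontr)
    assume "a \<notin> ?J"
    then have "?J +>\<^bsub>R\<^esub> a \<noteq> \<zero>\<^bsub>R Quot ?J\<^esub>"
      using a J.rcos_const_imp_mem by (auto simp: FactRing_def)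
    then have "?J +>\<^bsub>R\<^esub> a \<in> Units (R Quot ?J)"
      using assms(1) a by (simp add: is_local_ring_def is_division_ring_def FactRing_def R.a_rcosetsI J.a_subset)
    then obtain B where "B \<in> carrier (R Quot ?J)" "B \<otimes>\<^bsub>R Quot ?J\<^esub> (?J +>\<^bsub>R\<^esub> a) = \<one>\<^bsub>R Quot ?J\<^esub>"
      by (auto simp: Units_def)
    then obtain b where b: "b \<in> carrier R" "?J +>\<^bsub>R\<^esub> (b \<otimes>\<^bsub>R\<^esub> a) = ?J +>\<^bsub>R\<^esub> \<one>\<^bsub>R\<^esub>"
      using a by (auto simp: FactRing_simps J.rcoset_mult_add)
    then have "\<one>\<^bsub>R\<^esub> \<in> ?J +>\<^bsub>R\<^esub> (b \<otimes>\<^bsub>R\<^esub> a)"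
      using J.a_rcos_self by simp
    then obtain j where j: "j \<in> ?J" "\<one>\<^bsub>R\<^esub> = j \<oplus>\<^bsub>R\<^esub> b \<otimes>\<^bsub>R\<^esub> a"
      by (auto simp: a_r_coset_def r_coset_def)
    then have jR: "j \<in> carrier R" "j \<odot>\<^bsub>M\<^esub> y = \<zero>\<^bsub>M\<^esub>"
      using \<open>?J \<subseteq> ?A\<close> by auto
    have "y = (j \<oplus>\<^bsub>R\<^esub> b \<otimes>\<^bsub>R\<^esub> a) \<odot>\<^bsub>M\<^esub> y"
      using y by (simp flip: j(2))
    also have "\<dots> = \<zero>\<^bsub>M\<^esub>"
      using jR a b y ay by (simp add: smult_l_distr smult_assoc)
    finally have "y = \<zero>\<^bsub>M\<^esub>" .
    then show False
      using simple_cyclic_nonzero[OF simple] by simp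
  qed
qed

section \<open>Matrices of centralizing endomorphisms modulo the image and the kernel\<close>

lemma mat_abelian_monoid:
  assumes "abelian_monoid S"
  shows "abelian_monoid (opposite_ring (mat_ring S m))"
proof -
  interpret S: abelian_monoid S by fact
  show ?thesis
  proof (rule abelian_monoidI)
    fix A B C
    assume A: "A \<in> carrier (opposite_ring (mat_ring S m))"
      and B: "B \<in> carrier (opposite_ring (mat_ring S m))"
      and C: "C \<in> carrier (opposite_ring (mat_ring S m))"
    show "A \<oplus>\<^bsub>opposite_ring (mat_ring S m)\<^esub> B \<oplus>\<^bsub>opposite_ring (mat_ring S m)\<^esub> C =
        A \<oplus>\<^bsub>opposite_ring (mat_ring S m)\<^esub> (B \<oplus>\<^bsub>opposite_ring (mat_ring S m)\<^esub> C)"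
      using A B C by (auto simp: mat_ring_def opposite_ring_def PiE_iff S.a_assoc)
  next
    fix A B
    assume A: "A \<in> carrier (opposite_ring (mat_ring S m))"
      and B: "B \<in> carrier (opposite_ring (mat_ring S m))"
    show "A \<oplus>\<^bsub>opposite_ring (mat_ring S m)\<^esub> B \<in> carrier (opposite_ring (mat_ring S m))"
      using A B by (auto simp: mat_ring_def opposite_ring_def PiE_iff)
    show "A \<oplus>\<^bsub>opposite_ring (mat_ring S m)\<^esub> B = B \<oplus>\<^bsub>opposite_ring (mat_ring S m)\<^esub> A"
      using A B by (auto simp: mat_ring_def opposite_ring_def PiE_iff S.a_comm)
  next
    fix A assume "A \<in> carrier (opposite_ring (mat_ring S m))"
    then show "\<zero>\<^bsub>opposite_ring (mat_ring S m)\<^esub> \<oplus>\<^bsub>opposite_ring (mat_ring S m)\<^esub> A = A"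
      by (auto simp: mat_ring_def opposite_ring_def PiE_iff extensional_def fun_eq_iff)
  qed (auto simp: mat_ring_def opposite_ring_def PiE_iff)
qed

context module_endomorphism
begin

text \<open>Congruence modulo \<open>im \<phi> + ker \<phi>\<close>: the difference \<open>y - z\<close> is in this submodule if and only if
  \<open>\<phi>(y - z)\<close> is in \<open>\<phi>\<^sup>2 M\<close>. In the second form only one witness has to be carried around, and it is
  the form used in the final estimate.\<close>

definition top_cong :: "'m \<Rightarrow> 'm \<Rightarrow> bool" where
  "top_cong y z \<longleftrightarrow> y \<in> carrier M \<and> z \<in> carrier M \<and>
     (\<exists>w\<in>carrier M. \<phi> y = \<phi> z \<oplus>\<^bsub>M\<^esub> \<phi> (\<phi> w))"

lemma top_congI:
  "y \<in> carrier M \<Longrightarrow> z \<in> carrier M \<Longrightarrow> w \<in> carrier M \<Longrightarrow> \<phi> y = \<phi> z \<oplus>\<^bsub>M\<^esub> \<phi> (\<phi> w) \<Longrightarrow> top_cong y z"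
  by (auto simp: top_cong_def)

lemma top_congE:
  assumes "top_cong y z"
  obtains w where "y \<in> carrier M" "z \<in> carrier M" "w \<in> carrier M" "\<phi> y = \<phi> z \<oplus>\<^bsub>M\<^esub> \<phi> (\<phi> w)"
  using assms by (auto simp: top_cong_def)

lemma phi_closed [simp]: "y \<in> carrier M \<Longrightarrow> \<phi> y \<in> carrier M"
  and phi_zero [simp]: "\<phi> \<zero>\<^bsub>M\<^esub> = \<zero>\<^bsub>M\<^esub>"
  and phi_add: "y \<in> carrier M \<Longrightarrow> z \<in> carrier M \<Longrightarrow> \<phi> (y \<oplus>\<^bsub>M\<^esub> z) = \<phi> y \<oplus>\<^bsub>M\<^esub> \<phi> z"
  and phi_smult: "a \<in> carrier R \<Longrightarrow> y \<in> carrier M \<Longrightarrow> \<phi> (a \<odot>\<^bsub>M\<^esub> y) = a \<odot>\<^bsub>M\<^esub> \<phi> y"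
  using endo by (simp_all add: End_add End_smult)

lemma phi_pow_closed: "y \<in> carrier M \<Longrightarrow> (\<phi> ^^ d) y \<in> carrier M"
  by (induction d) simp_all

lemma Cen_commute_pow:
  assumes "\<psi> \<in> carrier (Cen R M \<phi>)" "y \<in> carrier M"
  shows "(\<phi> ^^ d) (\<psi> y) = \<psi> ((\<phi> ^^ d) y)"
  using assms phi_pow_closed by (induction d) (simp_all add: Cen_iff)

lemma top_cong_refl: "y \<in> carrier M \<Longrightarrow> top_cong y y"
  by (rule top_congI[of _ _ "\<zero>\<^bsub>M\<^esub>"]) simp_all

lemma top_cong_phi: "y \<in> carrier M \<Longrightarrow> top_cong (\<phi> y) \<zero>\<^bsub>M\<^esub>"
  by (rule top_congI[of _ _ y]) simp_all

lemma top_cong_kernel: "y \<in> carrier M \<Longrightarrow> \<phi> y = \<zero>\<^bsub>M\<^esub> \<Longrightarrow> top_cong y \<zero>\<^bsub>M\<^esub>"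
  by (rule top_congI[of _ _ "\<zero>\<^bsub>M\<^esub>"]) simp_all

lemma top_cong_trans:
  assumes "top_cong y z" "top_cong z u"
  shows "top_cong y u"
proof -
  from assms(1) obtain v where v: "y \<in> carrier M" "z \<in> carrier M" "v \<in> carrier M" "\<phi> y = \<phi> z \<oplus>\<^bsub>M\<^esub> \<phi> (\<phi> v)"
    by (rule top_congE)
  from assms(2) obtain w where w: "u \<in> carrier M" "w \<in> carrier M" "\<phi> z = \<phi> u \<oplus>\<^bsub>M\<^esub> \<phi> (\<phi> w)"
    by (rule top_congE)
  show ?thesis
    using v w by (intro top_congI[of _ _ "v \<oplus>\<^bsub>M\<^esub> w"]) (simp_all add: phi_add M.a_ac)
qed

lemma top_cong_add:
  assumes "top_cong y z" "top_cong y' z'"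
  shows "top_cong (y \<oplus>\<^bsub>M\<^esub> y') (z \<oplus>\<^bsub>M\<^esub> z')"
proof -
  from assms(1) obtain v where v: "y \<in> carrier M" "z \<in> carrier M" "v \<in> carrier M" "\<phi> y = \<phi> z \<oplus>\<^bsub>M\<^esub> \<phi> (\<phi> v)"
    by (rule top_congE)
  from assms(2) obtain w where w: "y' \<in> carrier M" "z' \<in> carrier M" "w \<in> carrier M" "\<phi> y' = \<phi> z' \<oplus>\<^bsub>M\<^esub> \<phi> (\<phi> w)"
    by (rule top_congE)
  show ?thesis
    using v w by (intro top_congI[of _ _ "v \<oplus>\<^bsub>M\<^esub> w"]) (simp_all add: phi_add M.a_ac)
qed

lemma top_cong_smult:
  assumes "a \<in> carrier R" "top_cong y z"
  shows "top_cong (a \<odot>\<^bsub>M\<^esub> y) (a \<odot>\<^bsub>M\<^esub> z)"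
proof -
  from assms(2) obtain w where w: "y \<in> carrier M" "z \<in> carrier M" "w \<in> carrier M" "\<phi> y = \<phi> z \<oplus>\<^bsub>M\<^esub> \<phi> (\<phi> w)"
    by (rule top_congE)
  then show ?thesis
    using assms(1) by (intro top_congI[of _ _ "a \<odot>\<^bsub>M\<^esub> w"]) (simp_all add: phi_smult smult_r_distr)
qed

lemma top_cong_Cen:
  assumes "\<psi> \<in> carrier (Cen R M \<phi>)" "top_cong y z"
  shows "top_cong (\<psi> y) (\<psi> z)"
proof -
  from assms(2) obtain w where w: "y \<in> carrier M" "z \<in> carrier M" "w \<in> carrier M" "\<phi> y = \<phi> z \<oplus>\<^bsub>M\<^esub> \<phi> (\<phi> w)"
    by (rule top_congE)
  have \<psi>: "\<psi> \<in> carrier (End_ring R M)" and comm: "\<And>u. u \<in> carrier M \<Longrightarrow> \<phi> (\<psi> u) = \<psi> (\<phi> u)"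
    using assms(1) by (simp_all add: Cen_iff)
  show ?thesis
    using w \<psi> by (intro top_congI[of _ _ "\<psi> w"]) (simp_all add: comm End_add)
qed

lemma top_cong_finsum:
  assumes "finite I" "\<And>i. i \<in> I \<Longrightarrow> top_cong (g i) (h i)"
  shows "top_cong (finsum M g I) (finsum M h I)"
  using assms
proof (induction I rule: finite_induct)
  case (insert i I)
  have "g \<in> insert i I \<rightarrow> carrier M" "h \<in> insert i I \<rightarrow> carrier M"
    using insert.prems by (auto simp: top_cong_def)
  then show ?case
    using insert by (simp add: M.finsum_insert top_cong_add)
qed (simp add: top_cong_refl)

text \<open>\<open>A\<close> is a matrix over \<open>R/J\<close>, while \<open>e\<close> is a family in an \<open>R\<close>-module, so a lift \<open>a\<close> of
  the entries to \<open>R\<close> occurs. Rows are indexed by the arguments of \<open>\<psi>\<close>. If \<open>e\<close> is the family of chain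
  heads, those of chains of length 1 are 0 modulo \<open>im \<phi> + ker \<phi>\<close>, so an endomorphism can have several matrices; only
  the existence of one in \<open>\<U>\<^sub>0(X)\<close> matters.\<close>

definition represents :: "nat \<Rightarrow> (nat \<Rightarrow> 'm) \<Rightarrow> ('m \<Rightarrow> 'm) \<Rightarrow> (nat \<times> nat \<Rightarrow> 'a set) \<Rightarrow> bool" where
  "represents m e \<psi> A \<longleftrightarrow> \<psi> \<in> carrier (Cen R M \<phi>) \<and> A \<in> extensional ({1..m} \<times> {1..m}) \<and>
     (\<exists>a. \<forall>\<delta>\<in>{1..m}. (\<forall>\<gamma>\<in>{1..m}. a \<delta> \<gamma> \<in> carrier R \<and> A (\<delta>, \<gamma>) = jacobson_radical R +>\<^bsub>R\<^esub> a \<delta> \<gamma>) \<and>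
        top_cong (\<psi> (e \<delta>)) (\<Oplus>\<^bsub>M\<^esub>\<gamma>\<in>{1..m}. a \<delta> \<gamma> \<odot>\<^bsub>M\<^esub> e \<gamma>))"

lemma representsI:
  assumes "\<psi> \<in> carrier (Cen R M \<phi>)" "A \<in> extensional ({1..m} \<times> {1..m})"
    and "\<And>\<delta> \<gamma>. \<delta> \<in> {1..m} \<Longrightarrow> \<gamma> \<in> {1..m} \<Longrightarrow> a \<delta> \<gamma> \<in> carrier R"
    and "\<And>\<delta> \<gamma>. \<delta> \<in> {1..m} \<Longrightarrow> \<gamma> \<in> {1..m} \<Longrightarrow> A (\<delta>, \<gamma>) = jacobson_radical R +>\<^bsub>R\<^esub> a \<delta> \<gamma>"
    and "\<And>\<delta>. \<delta> \<in> {1..m} \<Longrightarrow> top_cong (\<psi> (e \<delta>)) (\<Oplus>\<^bsub>M\<^esub>\<gamma>\<in>{1..m}. a \<delta> \<gamma> \<odot>\<^bsub>M\<^esub> e \<gamma>)"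
  shows "represents m e \<psi> A"
  unfolding represents_def using assms by blast

lemma representsE:
  assumes "represents m e \<psi> A"
  obtains a where "\<psi> \<in> carrier (Cen R M \<phi>)" "A \<in> extensional ({1..m} \<times> {1..m})"
    and "\<And>\<delta> \<gamma>. \<delta> \<in> {1..m} \<Longrightarrow> \<gamma> \<in> {1..m} \<Longrightarrow> a \<delta> \<gamma> \<in> carrier R"
    and "\<And>\<delta> \<gamma>. \<delta> \<in> {1..m} \<Longrightarrow> \<gamma> \<in> {1..m} \<Longrightarrow> A (\<delta>, \<gamma>) = jacobson_radical R +>\<^bsub>R\<^esub> a \<delta> \<gamma>"
    and "\<And>\<delta>. \<delta> \<in> {1..m} \<Longrightarrow> top_cong (\<psi> (e \<delta>)) (\<Oplus>\<^bsub>M\<^esub>\<gamma>\<in>{1..m}. a \<delta> \<gamma> \<odot>\<^bsub>M\<^esub> e \<gamma>)"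
  using assms unfolding represents_def by blast

sublocale J: ideal "jacobson_radical R" R
  by (rule R.jacobson_radical_ideal)

sublocale Q: ring "residue_quotient R"
  by (rule J.quotient_is_ring)

lemma coset_ops:
  assumes "a \<in> carrier R" "b \<in> carrier R"
  shows "(jacobson_radical R +>\<^bsub>R\<^esub> a) \<oplus>\<^bsub>residue_quotient R\<^esub> (jacobson_radical R +>\<^bsub>R\<^esub> b) =
      jacobson_radical R +>\<^bsub>R\<^esub> (a \<oplus>\<^bsub>R\<^esub> b)"
    and "(jacobson_radical R +>\<^bsub>R\<^esub> a) \<otimes>\<^bsub>residue_quotient R\<^esub> (jacobson_radical R +>\<^bsub>R\<^esub> b) =
      jacobson_radical R +>\<^bsub>R\<^esub> (a \<otimes>\<^bsub>R\<^esub> b)"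
  using assms by (simp_all add: FactRing_simps J.rcoset_mult_add J.a_rcos_sum)

lemma coset_closed: "a \<in> carrier R \<Longrightarrow> jacobson_radical R +>\<^bsub>R\<^esub> a \<in> carrier (residue_quotient R)"
  by (simp add: FactRing_def R.a_rcosetsI J.a_subset)

lemma coset_zero: "\<zero>\<^bsub>residue_quotient R\<^esub> = jacobson_radical R +>\<^bsub>R\<^esub> \<zero>\<^bsub>R\<^esub>"
  by (simp add: FactRing_def J.a_subset)

lemma coset_finsum:
  "g \<in> I \<rightarrow> carrier R \<Longrightarrow>
    jacobson_radical R +>\<^bsub>R\<^esub> finsum R g I = (\<Oplus>\<^bsub>residue_quotient R\<^esub>i\<in>I. jacobson_radical R +>\<^bsub>R\<^esub> g i)"
  by (rule additive_finsum) (auto simp: R.abelian_group_axioms Q.abelian_group_axioms coset_ops coset_closed)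

lemma represents_carrier:
  assumes "represents m e \<psi> A"
  shows "A \<in> carrier (mat_ring (residue_quotient R) m)"
proof -
  from assms obtain a where a: "A \<in> extensional ({1..m} \<times> {1..m})"
    "\<And>\<delta> \<gamma>. \<delta> \<in> {1..m} \<Longrightarrow> \<gamma> \<in> {1..m} \<Longrightarrow> a \<delta> \<gamma> \<in> carrier R"
    "\<And>\<delta> \<gamma>. \<delta> \<in> {1..m} \<Longrightarrow> \<gamma> \<in> {1..m} \<Longrightarrow> A (\<delta>, \<gamma>) = jacobson_radical R +>\<^bsub>R\<^esub> a \<delta> \<gamma>"
    by (rule representsE) blast
  have "A (\<delta>, \<gamma>) \<in> carrier (residue_quotient R)" if "\<delta> \<in> {1..m}" "\<gamma> \<in> {1..m}" for \<delta> \<gamma>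
    using coset_closed[OF a(2)[OF that]] a(3)[OF that] by simp
  then show ?thesis
    using a(1) by (auto simp: mat_ring_def PiE_iff)
qed

lemma represents_zero:
  assumes e: "\<And>\<delta>. \<delta> \<in> {1..m} \<Longrightarrow> e \<delta> \<in> carrier M"
  shows "represents m e \<zero>\<^bsub>Cen R M \<phi>\<^esub> \<zero>\<^bsub>opposite_ring (mat_ring (residue_quotient R) m)\<^esub>"
proof (rule representsI[where a = "\<lambda>_ _. \<zero>\<^bsub>R\<^esub>"])
  fix \<delta> assume \<delta>: "\<delta> \<in> {1..m}"
  have "(\<Oplus>\<^bsub>M\<^esub>\<gamma>\<in>{1..m}. \<zero>\<^bsub>R\<^esub> \<odot>\<^bsub>M\<^esub> e \<gamma>) = \<zero>\<^bsub>M\<^esub>"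
    using e by (intro M.add.finprod_one_eqI) auto
  then show "top_cong (\<zero>\<^bsub>Cen R M \<phi>\<^esub> (e \<delta>)) (\<Oplus>\<^bsub>M\<^esub>\<gamma>\<in>{1..m}. \<zero>\<^bsub>R\<^esub> \<odot>\<^bsub>M\<^esub> e \<gamma>)"
    using e[OF \<delta>] by (simp add: top_cong_refl)
qed (use Cen.zero_closed in \<open>auto simp: opposite_ring_def mat_ring_def coset_zero\<close>)

lemma represents_scalar:
  assumes e: "\<And>\<delta>. \<delta> \<in> {1..m} \<Longrightarrow> e \<delta> \<in> carrier M" and c: "c \<in> carrier (center_ring R)"
  shows "represents m e (\<lambda>y\<in>carrier M. c \<odot>\<^bsub>M\<^esub> y) (mat_scalar R m c)"
proof (rule representsI[where a = "\<lambda>\<delta> \<gamma>. if \<delta> = \<gamma> then c else \<zero>\<^bsub>R\<^esub>"])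
  interpret poly: central_algebra "center_ring R" "Cen R M \<phi>" "\<lambda>c. \<lambda>y\<in>carrier M. c \<odot>\<^bsub>M\<^esub> y"
    by (rule Cen_scalar_algebra)
  show "(\<lambda>y\<in>carrier M. c \<odot>\<^bsub>M\<^esub> y) \<in> carrier (Cen R M \<phi>)"
    using c by (rule poly.hom_closed)
  fix \<delta> assume \<delta>: "\<delta> \<in> {1..m}"
  have "(\<Oplus>\<^bsub>M\<^esub>\<gamma>\<in>{1..m}. (if \<delta> = \<gamma> then c else \<zero>\<^bsub>R\<^esub>) \<odot>\<^bsub>M\<^esub> e \<gamma>) =
      (\<Oplus>\<^bsub>M\<^esub>\<gamma>\<in>{1..m}. if \<delta> = \<gamma> then c \<odot>\<^bsub>M\<^esub> e \<gamma> else \<zero>\<^bsub>M\<^esub>)"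
    using e center_ring_memD[OF c] by (intro M.finsum_cong') auto
  also have "\<dots> = c \<odot>\<^bsub>M\<^esub> e \<delta>"
    using e center_ring_memD[OF c] \<delta> by (intro M.finsum_singleton) auto
  finally show "top_cong ((\<lambda>y\<in>carrier M. c \<odot>\<^bsub>M\<^esub> y) (e \<delta>))
      (\<Oplus>\<^bsub>M\<^esub>\<gamma>\<in>{1..m}. (if \<delta> = \<gamma> then c else \<zero>\<^bsub>R\<^esub>) \<odot>\<^bsub>M\<^esub> e \<gamma>)"
    using e \<delta> center_ring_memD[OF c] by (simp add: top_cong_refl)
qed (use center_ring_memD[OF c] in \<open>auto simp: mat_scalar_def coset_zero\<close>)

lemma represents_one:
  assumes e: "\<And>\<delta>. \<delta> \<in> {1..m} \<Longrightarrow> e \<delta> \<in> carrier M"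
  shows "represents m e \<one>\<^bsub>Cen R M \<phi>\<^esub> \<one>\<^bsub>opposite_ring (mat_ring (residue_quotient R) m)\<^esub>"
proof -
  interpret Z: ring "center_ring R"
    by (rule R.center_is_ring)
  have "\<one>\<^bsub>R\<^esub> \<in> carrier (center_ring R)"
    using Z.one_closed by simp
  moreover have "\<one>\<^bsub>Cen R M \<phi>\<^esub> = (\<lambda>y\<in>carrier M. \<one>\<^bsub>R\<^esub> \<odot>\<^bsub>M\<^esub> y)"
    by (auto simp: Cen_def End_ring_def)
  moreover have "\<one>\<^bsub>opposite_ring (mat_ring (residue_quotient R) m)\<^esub> = mat_scalar R m \<one>\<^bsub>R\<^esub>"
    by (auto simp: opposite_ring_def mat_ring_def mat_scalar_def FactRing_def restrict_def fun_eq_iff)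
  ultimately show ?thesis
    using represents_scalar[OF e] by simp
qed

lemma represents_add:
  assumes e: "\<And>\<delta>. \<delta> \<in> {1..m} \<Longrightarrow> e \<delta> \<in> carrier M"
    and \<psi>: "represents m e \<psi> A" and \<theta>: "represents m e \<theta> B"
  shows "represents m e (\<psi> \<oplus>\<^bsub>Cen R M \<phi>\<^esub> \<theta>) (A \<oplus>\<^bsub>opposite_ring (mat_ring (residue_quotient R) m)\<^esub> B)"
proof -
  from \<psi> obtain a where a: "\<psi> \<in> carrier (Cen R M \<phi>)"
    "\<And>\<delta> \<gamma>. \<delta> \<in> {1..m} \<Longrightarrow> \<gamma> \<in> {1..m} \<Longrightarrow> a \<delta> \<gamma> \<in> carrier R"
    "\<And>\<delta> \<gamma>. \<delta> \<in> {1..m} \<Longrightarrow> \<gamma> \<in> {1..m} \<Longrightarrow> A (\<delta>, \<gamma>) = jacobson_radical R +>\<^bsub>R\<^esub> a \<delta> \<gamma>"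
    "\<And>\<delta>. \<delta> \<in> {1..m} \<Longrightarrow> top_cong (\<psi> (e \<delta>)) (\<Oplus>\<^bsub>M\<^esub>\<gamma>\<in>{1..m}. a \<delta> \<gamma> \<odot>\<^bsub>M\<^esub> e \<gamma>)"
    by (rule representsE) blast
  from \<theta> obtain b where b: "\<theta> \<in> carrier (Cen R M \<phi>)"
    "\<And>\<delta> \<gamma>. \<delta> \<in> {1..m} \<Longrightarrow> \<gamma> \<in> {1..m} \<Longrightarrow> b \<delta> \<gamma> \<in> carrier R"
    "\<And>\<delta> \<gamma>. \<delta> \<in> {1..m} \<Longrightarrow> \<gamma> \<in> {1..m} \<Longrightarrow> B (\<delta>, \<gamma>) = jacobson_radical R +>\<^bsub>R\<^esub> b \<delta> \<gamma>"
    "\<And>\<delta>. \<delta> \<in> {1..m} \<Longrightarrow> top_cong (\<theta> (e \<delta>)) (\<Oplus>\<^bsub>M\<^esub>\<gamma>\<in>{1..m}. b \<delta> \<gamma> \<odot>\<^bsub>M\<^esub> e \<gamma>)"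
    by (rule representsE) blast
  show ?thesis
  proof (rule representsI[where a = "\<lambda>\<delta> \<gamma>. a \<delta> \<gamma> \<oplus>\<^bsub>R\<^esub> b \<delta> \<gamma>"])
    fix \<delta> assume \<delta>: "\<delta> \<in> {1..m}"
    have "(\<Oplus>\<^bsub>M\<^esub>\<gamma>\<in>{1..m}. (a \<delta> \<gamma> \<oplus>\<^bsub>R\<^esub> b \<delta> \<gamma>) \<odot>\<^bsub>M\<^esub> e \<gamma>) =
        (\<Oplus>\<^bsub>M\<^esub>\<gamma>\<in>{1..m}. a \<delta> \<gamma> \<odot>\<^bsub>M\<^esub> e \<gamma> \<oplus>\<^bsub>M\<^esub> b \<delta> \<gamma> \<odot>\<^bsub>M\<^esub> e \<gamma>)"
      using e a(2)[OF \<delta>] b(2)[OF \<delta>] by (intro M.finsum_cong') (auto simp: smult_l_distr)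
    also have "\<dots> = (\<Oplus>\<^bsub>M\<^esub>\<gamma>\<in>{1..m}. a \<delta> \<gamma> \<odot>\<^bsub>M\<^esub> e \<gamma>) \<oplus>\<^bsub>M\<^esub> (\<Oplus>\<^bsub>M\<^esub>\<gamma>\<in>{1..m}. b \<delta> \<gamma> \<odot>\<^bsub>M\<^esub> e \<gamma>)"
      using e a(2)[OF \<delta>] b(2)[OF \<delta>] by (intro M.finsum_addf) auto
    finally show "top_cong ((\<psi> \<oplus>\<^bsub>Cen R M \<phi>\<^esub> \<theta>) (e \<delta>)) (\<Oplus>\<^bsub>M\<^esub>\<gamma>\<in>{1..m}. (a \<delta> \<gamma> \<oplus>\<^bsub>R\<^esub> b \<delta> \<gamma>) \<odot>\<^bsub>M\<^esub> e \<gamma>)"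
      using top_cong_add[OF a(4)[OF \<delta>] b(4)[OF \<delta>]] e[OF \<delta>] by simp
  qed (use Cen.a_closed[OF a(1) b(1)] a b in
      \<open>simp_all add: opposite_ring_def mat_ring_def coset_ops del: Cen_ops\<close>)
qed

text \<open>The coefficients of \<open>\<theta>(e\<^bsub>\<delta>\<^esub>)\<close> can be pulled out of \<open>\<psi>\<close> to the left, so that they come before those of
  \<open>\<psi>(e\<^bsub>\<gamma>\<^esub>)\<close>. This reversal is the reason for the opposite matrix ring.\<close>

lemma represents_mult:
  assumes e: "\<And>\<delta>. \<delta> \<in> {1..m} \<Longrightarrow> e \<delta> \<in> carrier M"
    and \<psi>: "represents m e \<psi> A" and \<theta>: "represents m e \<theta> B"
  shows "represents m e (\<psi> \<otimes>\<^bsub>Cen R M \<phi>\<^esub> \<theta>) (A \<otimes>\<^bsub>opposite_ring (mat_ring (residue_quotient R) m)\<^esub> B)"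
proof -
  from \<psi> obtain a where a: "\<psi> \<in> carrier (Cen R M \<phi>)"
    "\<And>\<delta> \<gamma>. \<delta> \<in> {1..m} \<Longrightarrow> \<gamma> \<in> {1..m} \<Longrightarrow> a \<delta> \<gamma> \<in> carrier R"
    "\<And>\<delta> \<gamma>. \<delta> \<in> {1..m} \<Longrightarrow> \<gamma> \<in> {1..m} \<Longrightarrow> A (\<delta>, \<gamma>) = jacobson_radical R +>\<^bsub>R\<^esub> a \<delta> \<gamma>"
    "\<And>\<delta>. \<delta> \<in> {1..m} \<Longrightarrow> top_cong (\<psi> (e \<delta>)) (\<Oplus>\<^bsub>M\<^esub>\<gamma>\<in>{1..m}. a \<delta> \<gamma> \<odot>\<^bsub>M\<^esub> e \<gamma>)"
    by (rule representsE) blast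
  from \<theta> obtain b where b: "\<theta> \<in> carrier (Cen R M \<phi>)"
    "\<And>\<delta> \<gamma>. \<delta> \<in> {1..m} \<Longrightarrow> \<gamma> \<in> {1..m} \<Longrightarrow> b \<delta> \<gamma> \<in> carrier R"
    "\<And>\<delta> \<gamma>. \<delta> \<in> {1..m} \<Longrightarrow> \<gamma> \<in> {1..m} \<Longrightarrow> B (\<delta>, \<gamma>) = jacobson_radical R +>\<^bsub>R\<^esub> b \<delta> \<gamma>"
    "\<And>\<delta>. \<delta> \<in> {1..m} \<Longrightarrow> top_cong (\<theta> (e \<delta>)) (\<Oplus>\<^bsub>M\<^esub>\<gamma>\<in>{1..m}. b \<delta> \<gamma> \<odot>\<^bsub>M\<^esub> e \<gamma>)"
    by (rule representsE) blast
  have \<psi>_End: "\<psi> \<in> carrier (End_ring R M)"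
    using a(1) by (simp add: Cen_iff)
  show ?thesis
  proof (rule representsI[where a = "\<lambda>\<delta> \<epsilon>. \<Oplus>\<^bsub>R\<^esub>\<gamma>\<in>{1..m}. b \<delta> \<gamma> \<otimes>\<^bsub>R\<^esub> a \<gamma> \<epsilon>"])
    show "\<psi> \<otimes>\<^bsub>Cen R M \<phi>\<^esub> \<theta> \<in> carrier (Cen R M \<phi>)"
      using a(1) b(1) by (rule Cen.m_closed)
    show "A \<otimes>\<^bsub>opposite_ring (mat_ring (residue_quotient R) m)\<^esub> B \<in> extensional ({1..m} \<times> {1..m})"
      by (simp add: opposite_ring_def mat_ring_def)
  next
    fix \<delta> \<epsilon> assume \<delta>: "\<delta> \<in> {1..m}" and \<epsilon>: "\<epsilon> \<in> {1..m}"
    have ab: "b \<delta> \<gamma> \<otimes>\<^bsub>R\<^esub> a \<gamma> \<epsilon> \<in> carrier R" if "\<gamma> \<in> {1..m}" for \<gamma>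
      using a(2) b(2) \<delta> \<epsilon> that by simp
    then show "(\<Oplus>\<^bsub>R\<^esub>\<gamma>\<in>{1..m}. b \<delta> \<gamma> \<otimes>\<^bsub>R\<^esub> a \<gamma> \<epsilon>) \<in> carrier R"
      by (intro R.finsum_closed) blast
    have "(\<Oplus>\<^bsub>residue_quotient R\<^esub>\<gamma>\<in>{1..m}. B (\<delta>, \<gamma>) \<otimes>\<^bsub>residue_quotient R\<^esub> A (\<gamma>, \<epsilon>)) =
        (\<Oplus>\<^bsub>residue_quotient R\<^esub>\<gamma>\<in>{1..m}. jacobson_radical R +>\<^bsub>R\<^esub> (b \<delta> \<gamma> \<otimes>\<^bsub>R\<^esub> a \<gamma> \<epsilon>))"
      using a(2,3) b(2,3) \<delta> \<epsilon> coset_closed[OF ab] by (intro Q.finsum_cong' funcsetI) (simp_all add: coset_ops)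
    then show "(A \<otimes>\<^bsub>opposite_ring (mat_ring (residue_quotient R) m)\<^esub> B) (\<delta>, \<epsilon>) =
        jacobson_radical R +>\<^bsub>R\<^esub> (\<Oplus>\<^bsub>R\<^esub>\<gamma>\<in>{1..m}. b \<delta> \<gamma> \<otimes>\<^bsub>R\<^esub> a \<gamma> \<epsilon>)"
      using ab \<delta> \<epsilon> by (subst coset_finsum) (auto simp: opposite_ring_def mat_ring_def)
  next
    fix \<delta> assume \<delta>: "\<delta> \<in> {1..m}"
    have "top_cong (\<psi> (\<theta> (e \<delta>))) (\<psi> (\<Oplus>\<^bsub>M\<^esub>\<gamma>\<in>{1..m}. b \<delta> \<gamma> \<odot>\<^bsub>M\<^esub> e \<gamma>))"
      using a(1) b(4)[OF \<delta>] by (rule top_cong_Cen)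
    also have "\<psi> (\<Oplus>\<^bsub>M\<^esub>\<gamma>\<in>{1..m}. b \<delta> \<gamma> \<odot>\<^bsub>M\<^esub> e \<gamma>) = (\<Oplus>\<^bsub>M\<^esub>\<gamma>\<in>{1..m}. \<psi> (b \<delta> \<gamma> \<odot>\<^bsub>M\<^esub> e \<gamma>))"
      using \<psi>_End b(2)[OF \<delta>] e by (intro End_finsum) auto
    also have "\<dots> = (\<Oplus>\<^bsub>M\<^esub>\<gamma>\<in>{1..m}. b \<delta> \<gamma> \<odot>\<^bsub>M\<^esub> \<psi> (e \<gamma>))"
      using \<psi>_End b(2)[OF \<delta>] e by (intro M.finsum_cong') (auto simp: End_smult)
    finally have 1: "top_cong (\<psi> (\<theta> (e \<delta>))) (\<Oplus>\<^bsub>M\<^esub>\<gamma>\<in>{1..m}. b \<delta> \<gamma> \<odot>\<^bsub>M\<^esub> \<psi> (e \<gamma>))" .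
    have 2: "top_cong (\<Oplus>\<^bsub>M\<^esub>\<gamma>\<in>{1..m}. b \<delta> \<gamma> \<odot>\<^bsub>M\<^esub> \<psi> (e \<gamma>))
        (\<Oplus>\<^bsub>M\<^esub>\<gamma>\<in>{1..m}. b \<delta> \<gamma> \<odot>\<^bsub>M\<^esub> (\<Oplus>\<^bsub>M\<^esub>\<epsilon>\<in>{1..m}. a \<gamma> \<epsilon> \<odot>\<^bsub>M\<^esub> e \<epsilon>))"
      using b(2)[OF \<delta>] a(4) by (intro top_cong_finsum top_cong_smult) auto
    have closed: "b \<delta> \<gamma> \<odot>\<^bsub>M\<^esub> (a \<gamma> \<epsilon> \<odot>\<^bsub>M\<^esub> e \<epsilon>) \<in> carrier M" "a \<gamma> \<epsilon> \<odot>\<^bsub>M\<^esub> e \<epsilon> \<in> carrier M"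
      if "\<gamma> \<in> {1..m}" "\<epsilon> \<in> {1..m}" for \<gamma> \<epsilon>
      using that a(2) b(2)[OF \<delta>] e by auto
    have "(\<Oplus>\<^bsub>M\<^esub>\<gamma>\<in>{1..m}. b \<delta> \<gamma> \<odot>\<^bsub>M\<^esub> (\<Oplus>\<^bsub>M\<^esub>\<epsilon>\<in>{1..m}. a \<gamma> \<epsilon> \<odot>\<^bsub>M\<^esub> e \<epsilon>)) =
        (\<Oplus>\<^bsub>M\<^esub>\<gamma>\<in>{1..m}. \<Oplus>\<^bsub>M\<^esub>\<epsilon>\<in>{1..m}. b \<delta> \<gamma> \<odot>\<^bsub>M\<^esub> (a \<gamma> \<epsilon> \<odot>\<^bsub>M\<^esub> e \<epsilon>))"
      using b(2)[OF \<delta>] closed by (intro M.finsum_cong' smult_finsum) (auto intro!: M.finsum_closed)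
    also have "\<dots> = (\<Oplus>\<^bsub>M\<^esub>\<epsilon>\<in>{1..m}. \<Oplus>\<^bsub>M\<^esub>\<gamma>\<in>{1..m}. b \<delta> \<gamma> \<odot>\<^bsub>M\<^esub> (a \<gamma> \<epsilon> \<odot>\<^bsub>M\<^esub> e \<epsilon>))"
      using closed by (intro M.finsum_swap) auto
    also have "\<dots> = (\<Oplus>\<^bsub>M\<^esub>\<epsilon>\<in>{1..m}. (\<Oplus>\<^bsub>R\<^esub>\<gamma>\<in>{1..m}. b \<delta> \<gamma> \<otimes>\<^bsub>R\<^esub> a \<gamma> \<epsilon>) \<odot>\<^bsub>M\<^esub> e \<epsilon>)"
    proof (rule M.finsum_cong')
      fix \<epsilon> assume \<epsilon>: "\<epsilon> \<in> {1..m}"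
      have "(\<Oplus>\<^bsub>R\<^esub>\<gamma>\<in>{1..m}. b \<delta> \<gamma> \<otimes>\<^bsub>R\<^esub> a \<gamma> \<epsilon>) \<odot>\<^bsub>M\<^esub> e \<epsilon> = (\<Oplus>\<^bsub>M\<^esub>\<gamma>\<in>{1..m}. (b \<delta> \<gamma> \<otimes>\<^bsub>R\<^esub> a \<gamma> \<epsilon>) \<odot>\<^bsub>M\<^esub> e \<epsilon>)"
        using a(2) b(2)[OF \<delta>] e \<epsilon> by (intro finsum_smult) auto
      also have "\<dots> = (\<Oplus>\<^bsub>M\<^esub>\<gamma>\<in>{1..m}. b \<delta> \<gamma> \<odot>\<^bsub>M\<^esub> (a \<gamma> \<epsilon> \<odot>\<^bsub>M\<^esub> e \<epsilon>))"
        using a(2) b(2)[OF \<delta>] e \<epsilon> by (intro M.finsum_cong') (auto simp: smult_assoc)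
      finally show "(\<Oplus>\<^bsub>M\<^esub>\<gamma>\<in>{1..m}. b \<delta> \<gamma> \<odot>\<^bsub>M\<^esub> (a \<gamma> \<epsilon> \<odot>\<^bsub>M\<^esub> e \<epsilon>)) =
          (\<Oplus>\<^bsub>R\<^esub>\<gamma>\<in>{1..m}. b \<delta> \<gamma> \<otimes>\<^bsub>R\<^esub> a \<gamma> \<epsilon>) \<odot>\<^bsub>M\<^esub> e \<epsilon>"
        by simp
    qed (use a(2) b(2)[OF \<delta>] e in \<open>auto intro!: smult_closed R.finsum_closed\<close>)
    finally show "top_cong ((\<psi> \<otimes>\<^bsub>Cen R M \<phi>\<^esub> \<theta>) (e \<delta>))
        (\<Oplus>\<^bsub>M\<^esub>\<epsilon>\<in>{1..m}. (\<Oplus>\<^bsub>R\<^esub>\<gamma>\<in>{1..m}. b \<delta> \<gamma> \<otimes>\<^bsub>R\<^esub> a \<gamma> \<epsilon>) \<odot>\<^bsub>M\<^esub> e \<epsilon>)"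
      using top_cong_trans[OF 1 2] e[OF \<delta>] by simp
  qed
qed

lemma represents_eval:
  assumes e: "\<And>\<delta>. \<delta> \<in> {1..m} \<Longrightarrow> e \<delta> \<in> carrier M"
    and f: "f \<in> carrier (ncpoly_ring (center_ring R) r)"
    and v: "\<And>j. j \<in> {1..r} \<Longrightarrow> represents m e (v j) (u j)"
  shows "represents m e
    (ncpoly_eval (center_ring R) (Cen R M \<phi>) (\<lambda>c. \<lambda>y\<in>carrier M. c \<odot>\<^bsub>M\<^esub> y) f v)
    (ncpoly_eval (center_ring R) (opposite_ring (mat_ring (residue_quotient R) m)) (mat_scalar R m) f u)"
proof (rule ncpoly_eval_related[where P = "represents m e"])
  show "abelian_monoid (opposite_ring (mat_ring (residue_quotient R) m))"
    using Q.abelian_monoid_axioms by (rule mat_abelian_monoid)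
  show "\<psi> \<in> carrier (Cen R M \<phi>) \<and> A \<in> carrier (opposite_ring (mat_ring (residue_quotient R) m))"
    if "represents m e \<psi> A" for \<psi> A
    using represents_carrier[OF that] that by (simp add: opposite_ring_def represents_def)
qed (use e f v Cen.abelian_monoid_axioms represents_zero represents_one represents_add
    represents_mult represents_scalar in \<open>simp_all del: Cen_ops\<close>)

end

section \<open>Nilpotent Jordan bases\<close>

locale jordan_module = module_endomorphism R M \<phi>
  for R :: "('a, 'b) ring_scheme" and M :: "('a, 'm, 'c) module_scheme" and \<phi> :: "'m \<Rightarrow> 'm" +
  fixes m :: nat and k :: "nat \<Rightarrow> nat" and x :: "nat \<Rightarrow> nat \<Rightarrow> 'm"
  assumes local_ring: "is_local_ring R"
    and base: "nilpotent_jordan_base R M \<phi> {1..m} k x"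
begin

definition base_indices :: "(nat \<times> nat) set" where
  "base_indices = (SIGMA \<gamma>:{1..m}. {1..k \<gamma>})"

lemma finite_base_indices: "finite base_indices"
  by (simp add: base_indices_def)

lemma base_carrier [simp]: "\<gamma> \<in> {1..m} \<Longrightarrow> i \<in> {1..k \<gamma>} \<Longrightarrow> x \<gamma> i \<in> carrier M"
  and base_simple: "\<gamma> \<in> {1..m} \<Longrightarrow> i \<in> {1..k \<gamma>} \<Longrightarrow> simple_submodule R M (cyclic_submodule R M (x \<gamma> i))"
  and length_pos: "\<gamma> \<in> {1..m} \<Longrightarrow> 1 \<le> k \<gamma>"
  and phi_base: "\<gamma> \<in> {1..m} \<Longrightarrow> 1 \<le> i \<Longrightarrow> i < k \<gamma> \<Longrightarrow> \<phi> (x \<gamma> i) = x \<gamma> (Suc i)"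
  and phi_end: "\<gamma> \<in> {1..m} \<Longrightarrow> \<phi> (x \<gamma> (k \<gamma>)) = \<zero>\<^bsub>M\<^esub>"
  using base by (auto simp: nilpotent_jordan_base_def)

lemma top_carrier: "\<gamma> \<in> {1..m} \<Longrightarrow> x \<gamma> 1 \<in> carrier M"
  using length_pos by simp

lemma base_annihilator:
  "\<gamma> \<in> {1..m} \<Longrightarrow> i \<in> {1..k \<gamma>} \<Longrightarrow> a \<in> carrier R \<Longrightarrow>
    a \<odot>\<^bsub>M\<^esub> x \<gamma> i = \<zero>\<^bsub>M\<^esub> \<longleftrightarrow> a \<in> jacobson_radical R"
  using local_ring base_simple by (intro annihilator_simple_local) simp_all

text \<open>As there are finitely many summands, the sum over the support of a family is the sum over all indices.\<close>

lemma base_decomposition: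
  assumes y: "y \<in> carrier M"
  shows "\<exists>!g. g \<in> (\<Pi>\<^sub>E p\<in>base_indices. cyclic_submodule R M (x (fst p) (snd p))) \<and> y = (\<Oplus>\<^bsub>M\<^esub>p\<in>base_indices. g p)"
proof -
  have sub: "cyclic_submodule R M (x (fst p) (snd p)) \<subseteq> carrier M" if "p \<in> base_indices" for p
    using that by (auto simp: base_indices_def cyclic_submodule_def)
  have eq: "(\<Oplus>\<^bsub>M\<^esub>p\<in>{p \<in> base_indices. g p \<noteq> \<zero>\<^bsub>M\<^esub>}. g p) = (\<Oplus>\<^bsub>M\<^esub>p\<in>base_indices. g p)"
    if "g \<in> (\<Pi>\<^sub>E p\<in>base_indices. cyclic_submodule R M (x (fst p) (snd p)))" for g
    using finite_base_indices that sub by (intro M.add.finprod_mono_neutral_cong_left) (auto simp: PiE_iff)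
  have "\<exists>!g. g \<in> (\<Pi>\<^sub>E p\<in>base_indices. cyclic_submodule R M (x (fst p) (snd p))) \<and>
      finite {p \<in> base_indices. g p \<noteq> \<zero>\<^bsub>M\<^esub>} \<and> y = (\<Oplus>\<^bsub>M\<^esub>p\<in>{p \<in> base_indices. g p \<noteq> \<zero>\<^bsub>M\<^esub>}. g p)"
    using base y unfolding nilpotent_jordan_base_def internal_direct_sum_def base_indices_def case_prod_unfold
    by blast
  then show ?thesis
    using eq finite_base_indices by (elim ex1E) (intro ex1I; auto)
qed

lemma base_span:
  assumes "y \<in> carrier M"
  obtains c where "\<And>p. p \<in> base_indices \<Longrightarrow> c p \<in> carrier R" "y = (\<Oplus>\<^bsub>M\<^esub>p\<in>base_indices. c p \<odot>\<^bsub>M\<^esub> x (fst p) (snd p))"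
proof -
  obtain g where g: "g \<in> (\<Pi>\<^sub>E p\<in>base_indices. cyclic_submodule R M (x (fst p) (snd p)))" "y = (\<Oplus>\<^bsub>M\<^esub>p\<in>base_indices. g p)"
    using base_decomposition[OF assms] by blast
  then have "\<forall>p\<in>base_indices. \<exists>a\<in>carrier R. g p = a \<odot>\<^bsub>M\<^esub> x (fst p) (snd p)"
    by (auto simp: PiE_iff cyclic_submodule_def)
  then obtain c where c: "\<And>p. p \<in> base_indices \<Longrightarrow> c p \<in> carrier R" "\<And>p. p \<in> base_indices \<Longrightarrow> g p = c p \<odot>\<^bsub>M\<^esub> x (fst p) (snd p)"
    by metis
  have "y = (\<Oplus>\<^bsub>M\<^esub>p\<in>base_indices. c p \<odot>\<^bsub>M\<^esub> x (fst p) (snd p))"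
    unfolding g(2) using c by (intro M.finsum_cong') (auto simp: base_indices_def)
  then show ?thesis
    using that c(1) by blast
qed

lemma base_independent:
  assumes c: "\<And>p. p \<in> base_indices \<Longrightarrow> c p \<in> carrier R"
    and zero: "(\<Oplus>\<^bsub>M\<^esub>p\<in>base_indices. c p \<odot>\<^bsub>M\<^esub> x (fst p) (snd p)) = \<zero>\<^bsub>M\<^esub>" and p: "p \<in> base_indices"
  shows "c p \<odot>\<^bsub>M\<^esub> x (fst p) (snd p) = \<zero>\<^bsub>M\<^esub>"
proof -
  let ?g = "\<lambda>p\<in>base_indices. c p \<odot>\<^bsub>M\<^esub> x (fst p) (snd p)" and ?z = "\<lambda>p\<in>base_indices. \<zero>\<^bsub>M\<^esub>"
  have "?g \<in> (\<Pi>\<^sub>E p\<in>base_indices. cyclic_submodule R M (x (fst p) (snd p)))"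
    using c by (auto simp: cyclic_submodule_def)
  moreover have "\<zero>\<^bsub>M\<^esub> = (\<Oplus>\<^bsub>M\<^esub>p\<in>base_indices. ?g p)"
    unfolding zero[symmetric] using c by (intro M.finsum_cong') (auto simp: base_indices_def)
  moreover have "\<zero>\<^bsub>M\<^esub> \<in> cyclic_submodule R M (x (fst p) (snd p))" if "p \<in> base_indices" for p
    using that by (auto simp: cyclic_submodule_def base_indices_def intro!: exI[of _ "\<zero>\<^bsub>R\<^esub>"])
  then have "?z \<in> (\<Pi>\<^sub>E p\<in>base_indices. cyclic_submodule R M (x (fst p) (snd p)))"
    by auto
  moreover have "\<zero>\<^bsub>M\<^esub> = (\<Oplus>\<^bsub>M\<^esub>p\<in>base_indices. ?z p)"
    by (intro M.add.finprod_one_eqI[symmetric]) simp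
  ultimately have "?g = ?z"
    using base_decomposition[OF M.zero_closed] by blast
  then have "?g p = ?z p"
    by (rule fun_cong)
  then show ?thesis
    using p by simp
qed

lemma phi_pow_base:
  assumes "\<gamma> \<in> {1..m}" "1 \<le> i"
  shows "i + d \<le> k \<gamma> \<Longrightarrow> (\<phi> ^^ d) (x \<gamma> i) = x \<gamma> (i + d)"
    and "i \<le> k \<gamma> \<Longrightarrow> k \<gamma> < i + d \<Longrightarrow> (\<phi> ^^ d) (x \<gamma> i) = \<zero>\<^bsub>M\<^esub>"
proof -
  show "(\<phi> ^^ d) (x \<gamma> i) = x \<gamma> (i + d)" if "i + d \<le> k \<gamma>" for d
    using that assms by (induction d) (simp_all add: phi_base)
  then have last: "(\<phi> ^^ (k \<gamma> - i)) (x \<gamma> i) = x \<gamma> (k \<gamma>)" if "i \<le> k \<gamma>"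
    using that by simp
  have zero: "(\<phi> ^^ d) \<zero>\<^bsub>M\<^esub> = \<zero>\<^bsub>M\<^esub>" for d
    by (induction d) simp_all
  assume "i \<le> k \<gamma>" "k \<gamma> < i + d"
  then have "d = (d - Suc (k \<gamma> - i)) + (Suc (k \<gamma> - i))"
    by simp
  then have "(\<phi> ^^ d) (x \<gamma> i) = (\<phi> ^^ (d - Suc (k \<gamma> - i))) (\<phi> ((\<phi> ^^ (k \<gamma> - i)) (x \<gamma> i)))"
    by (metis comp_apply funpow.simps(2) funpow_add)
  then show "(\<phi> ^^ d) (x \<gamma> i) = \<zero>\<^bsub>M\<^esub>"
    using last phi_end assms(1) zero \<open>i \<le> k \<gamma>\<close> by simp
qed

lemma phi_pow_combination:
  assumes "\<And>p. p \<in> I \<Longrightarrow> c p \<in> carrier R" "\<And>p. p \<in> I \<Longrightarrow> e p \<in> carrier M"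
  shows "(\<phi> ^^ d) (\<Oplus>\<^bsub>M\<^esub>p\<in>I. c p \<odot>\<^bsub>M\<^esub> e p) = (\<Oplus>\<^bsub>M\<^esub>p\<in>I. c p \<odot>\<^bsub>M\<^esub> (\<phi> ^^ d) (e p))"
proof (induction d)
  case (Suc d)
  have "(\<phi> ^^ Suc d) (\<Oplus>\<^bsub>M\<^esub>p\<in>I. c p \<odot>\<^bsub>M\<^esub> e p) = (\<Oplus>\<^bsub>M\<^esub>p\<in>I. \<phi> (c p \<odot>\<^bsub>M\<^esub> (\<phi> ^^ d) (e p)))"
    using Suc assms endo phi_pow_closed by (simp add: End_finsum Pi_iff)
  also have "\<dots> = (\<Oplus>\<^bsub>M\<^esub>p\<in>I. c p \<odot>\<^bsub>M\<^esub> (\<phi> ^^ Suc d) (e p))"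
    using assms phi_pow_closed by (intro M.finsum_cong') (auto simp: phi_smult)
  finally show ?case .
qed simp

text \<open>Applying \<open>\<phi>\<close> to the power \<open>d\<close> shifts every chain by \<open>d\<close> places and drops what is pushed beyond its
  end. The head \<open>x\<^bsub>\<gamma>,1\<^esub>\<close> survives as \<open>x\<^bsub>\<gamma>,d+1\<^esub>\<close> if \<open>d < k\<^bsub>\<gamma>\<^esub>\<close>, and the shifted base elements
  are still independent, so its coefficient annihilates a generator of a simple module and lies in \<open>J\<close>.\<close>

lemma top_coefficient_radical:
  assumes c: "\<And>p. p \<in> base_indices \<Longrightarrow> c p \<in> carrier R"
    and zero: "(\<phi> ^^ d) (\<Oplus>\<^bsub>M\<^esub>p\<in>base_indices. c p \<odot>\<^bsub>M\<^esub> x (fst p) (snd p)) = \<zero>\<^bsub>M\<^esub>"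
    and \<gamma>: "\<gamma> \<in> {1..m}" "d < k \<gamma>"
  shows "c (\<gamma>, 1) \<in> jacobson_radical R"
proof -
  \<comment> \<open>\<open>T\<close> indexes the base elements that survive the shift \<open>s\<close>, and \<open>b\<close> is the shifted family of coefficients.\<close>
  define T where "T = {p \<in> base_indices. snd p + d \<le> k (fst p)}"
  define s where "s p = (fst p, snd p + d)" for p :: "nat \<times> nat"
  define b where "b q = (if d < snd q then c (fst q, snd q - d) else \<zero>\<^bsub>R\<^esub>)" for q
  have x_closed: "x (fst p) (snd p) \<in> carrier M" if "p \<in> base_indices" for p
    using that by (auto simp: base_indices_def)
  have sT: "s ` T \<subseteq> base_indices"
    by (auto simp: s_def T_def base_indices_def)
  have b: "b q \<in> carrier R" if "q \<in> base_indices" for q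
  proof -
    have "(fst q, snd q - d) \<in> base_indices" if "d < snd q"
      using \<open>q \<in> base_indices\<close> that by (auto simp: base_indices_def)
    then show ?thesis
      using c by (simp add: b_def)
  qed
  have "(\<Oplus>\<^bsub>M\<^esub>q\<in>base_indices. b q \<odot>\<^bsub>M\<^esub> x (fst q) (snd q)) = (\<Oplus>\<^bsub>M\<^esub>q\<in>s ` T. b q \<odot>\<^bsub>M\<^esub> x (fst q) (snd q))"
  proof (rule M.add.finprod_mono_neutral_cong_right)
    fix q assume q: "q \<in> base_indices - s ` T"
    have "\<not> d < snd q"
    proof
      assume d: "d < snd q"
      have "(fst q, snd q - d) \<in> T"
        using q d by (auto simp: T_def base_indices_def)
      moreover have "q = s (fst q, snd q - d)"
        using d by (simp add: s_def)
      ultimately show False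
        using q by blast
    qed
    then show "b q \<odot>\<^bsub>M\<^esub> x (fst q) (snd q) = \<zero>\<^bsub>M\<^esub>"
      using q x_closed by (simp add: b_def)
  qed (use finite_base_indices sT b x_closed in auto)
  also have "\<dots> = (\<Oplus>\<^bsub>M\<^esub>p\<in>T. b (s p) \<odot>\<^bsub>M\<^esub> x (fst (s p)) (snd (s p)))"
    using sT b x_closed by (intro M.finsum_reindex) (auto simp: inj_on_def s_def)
  also have "\<dots> = (\<Oplus>\<^bsub>M\<^esub>p\<in>base_indices. c p \<odot>\<^bsub>M\<^esub> (\<phi> ^^ d) (x (fst p) (snd p)))"
  proof (rule M.add.finprod_mono_neutral_cong_left)
    show "T \<subseteq> base_indices"
      by (auto simp: T_def)
    show "c p \<odot>\<^bsub>M\<^esub> (\<phi> ^^ d) (x (fst p) (snd p)) = \<zero>\<^bsub>M\<^esub>" if "p \<in> base_indices - T" for p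
      using that c by (auto simp: T_def base_indices_def phi_pow_base(2))
    show "b (s p) \<odot>\<^bsub>M\<^esub> x (fst (s p)) (snd (s p)) = c p \<odot>\<^bsub>M\<^esub> (\<phi> ^^ d) (x (fst p) (snd p))" if "p \<in> T" for p
      using that by (auto simp: T_def base_indices_def b_def s_def phi_pow_base(1))
  qed (use finite_base_indices c x_closed phi_pow_closed in auto)
  also have "\<dots> = \<zero>\<^bsub>M\<^esub>"
    using zero phi_pow_combination[of base_indices c "\<lambda>p. x (fst p) (snd p)" d] c x_closed by simp
  finally have "b (\<gamma>, Suc d) \<odot>\<^bsub>M\<^esub> x \<gamma> (Suc d) = \<zero>\<^bsub>M\<^esub>"
    using base_independent[of b "(\<gamma>, Suc d)"] b \<gamma> by (simp add: base_indices_def)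
  moreover have "b (\<gamma>, Suc d) = c (\<gamma>, 1)" "c (\<gamma>, 1) \<in> carrier R"
    using c \<gamma> by (simp_all add: b_def base_indices_def)
  ultimately show ?thesis
    using base_annihilator[of \<gamma> "Suc d"] \<gamma> by simp
qed

text \<open>Modulo \<open>im \<phi> + ker \<phi>\<close> all base elements beyond the heads vanish, and so do the heads of chains of
  length 1. Of the remaining coefficients of \<open>\<psi>(x\<^bsub>\<delta>,1\<^esub>)\<close>, those at longer chains act as 0 because
  \<open>\<phi>\<close> to the power \<open>k\<^bsub>\<delta>\<^esub>\<close> kills \<open>x\<^bsub>\<delta>,1\<^esub>\<close> and commutes with \<open>\<psi>\<close>.\<close>

lemma ex_U0_represents:
  assumes \<psi>: "\<psi> \<in> carrier (Cen R M \<phi>)"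
  shows "\<exists>A\<in>U0 R m k. represents m (\<lambda>\<delta>. x \<delta> 1) \<psi> A"
proof -
  have \<psi>_End: "\<psi> \<in> carrier (End_ring R M)"
    using \<psi> by (simp add: Cen_iff)
  have "\<exists>c. (\<forall>p\<in>base_indices. c p \<in> carrier R) \<and> \<psi> (x \<delta> 1) = (\<Oplus>\<^bsub>M\<^esub>p\<in>base_indices. c p \<odot>\<^bsub>M\<^esub> x (fst p) (snd p))"
    if "\<delta> \<in> {1..m}" for \<delta>
    using base_span[OF End_closed[OF \<psi>_End top_carrier[OF that]]] by metis
  then obtain c where c: "\<And>\<delta> p. \<delta> \<in> {1..m} \<Longrightarrow> p \<in> base_indices \<Longrightarrow> c \<delta> p \<in> carrier R"
    and expansion: "\<And>\<delta>. \<delta> \<in> {1..m} \<Longrightarrow> \<psi> (x \<delta> 1) = (\<Oplus>\<^bsub>M\<^esub>p\<in>base_indices. c \<delta> p \<odot>\<^bsub>M\<^esub> x (fst p) (snd p))"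
    by metis
  define a where "a \<delta> \<gamma> = (if k \<delta> < k \<gamma> \<or> k \<gamma> = 1 then \<zero>\<^bsub>R\<^esub> else c \<delta> (\<gamma>, 1))" for \<delta> \<gamma>
  define A where "A = (\<lambda>(\<delta>, \<gamma>)\<in>{1..m} \<times> {1..m}. jacobson_radical R +>\<^bsub>R\<^esub> a \<delta> \<gamma>)"
  have a: "a \<delta> \<gamma> \<in> carrier R" if "\<delta> \<in> {1..m}" "\<gamma> \<in> {1..m}" for \<delta> \<gamma>
    using c that length_pos by (simp add: a_def base_indices_def)
  have rep: "represents m (\<lambda>\<delta>. x \<delta> 1) \<psi> A"
  proof (rule representsI[where a = a])
    fix \<delta> assume \<delta>: "\<delta> \<in> {1..m}"
    have x_closed: "x (fst p) (snd p) \<in> carrier M" if "p \<in> base_indices" for p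
      using that by (auto simp: base_indices_def)
    have "(\<phi> ^^ k \<delta>) (\<psi> (x \<delta> 1)) = \<zero>\<^bsub>M\<^esub>"
      using \<delta> length_pos[OF \<delta>] \<psi>_End top_carrier by (simp add: Cen_commute_pow[OF \<psi>] phi_pow_base(2))
    then have "(\<phi> ^^ k \<delta>) (\<Oplus>\<^bsub>M\<^esub>p\<in>base_indices. c \<delta> p \<odot>\<^bsub>M\<^esub> x (fst p) (snd p)) = \<zero>\<^bsub>M\<^esub>"
      unfolding expansion[OF \<delta>] .
    then have radical: "c \<delta> (\<gamma>, 1) \<in> jacobson_radical R" if "\<gamma> \<in> {1..m}" "k \<delta> < k \<gamma>" for \<gamma>
      using that by (intro top_coefficient_radical[of "c \<delta>" "k \<delta>"] c[OF \<delta>])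
    have "top_cong (\<Oplus>\<^bsub>M\<^esub>p\<in>base_indices. c \<delta> p \<odot>\<^bsub>M\<^esub> x (fst p) (snd p))
        (\<Oplus>\<^bsub>M\<^esub>p\<in>base_indices. if snd p = 1 then a \<delta> (fst p) \<odot>\<^bsub>M\<^esub> x (fst p) 1 else \<zero>\<^bsub>M\<^esub>)"
    proof (rule top_cong_finsum[OF finite_base_indices])
      fix p assume p: "p \<in> base_indices"
      obtain \<gamma> i where p_eq: "p = (\<gamma>, i)" and \<gamma>: "\<gamma> \<in> {1..m}" and i: "i \<in> {1..k \<gamma>}"
        using p by (auto simp: base_indices_def)
      have cR: "c \<delta> (\<gamma>, i) \<in> carrier R"
        using c[OF \<delta> p] p_eq by simp
      have smult_zero: "top_cong (c \<delta> (\<gamma>, i) \<odot>\<^bsub>M\<^esub> x \<gamma> i) \<zero>\<^bsub>M\<^esub>" if "top_cong (x \<gamma> i) \<zero>\<^bsub>M\<^esub>"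
        using top_cong_smult[OF cR that] cR by simp
      have "top_cong (c \<delta> (\<gamma>, i) \<odot>\<^bsub>M\<^esub> x \<gamma> i) (if i = 1 then a \<delta> \<gamma> \<odot>\<^bsub>M\<^esub> x \<gamma> 1 else \<zero>\<^bsub>M\<^esub>)"
      proof (cases "i = 1")
        case False
        then have "x \<gamma> i = \<phi> (x \<gamma> (i - 1))"
          using phi_base[OF \<gamma>, of "i - 1"] i by auto
        moreover have "x \<gamma> (i - 1) \<in> carrier M"
          using \<gamma> i False by (intro base_carrier) auto
        ultimately show ?thesis
          using False smult_zero top_cong_phi by simp
      next
        case True
        consider "k \<gamma> = 1" | "k \<gamma> \<noteq> 1" "k \<delta> < k \<gamma>" | "k \<gamma> \<noteq> 1" "\<not> k \<delta> < k \<gamma>"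
          by blast
        then show ?thesis
        proof cases
          case 1
          then have "top_cong (x \<gamma> i) \<zero>\<^bsub>M\<^esub>"
            using True phi_end[OF \<gamma>] top_carrier[OF \<gamma>] by (intro top_cong_kernel) simp_all
          then show ?thesis
            using 1 True smult_zero top_carrier[OF \<gamma>] by (simp add: a_def)
        next
          case 2
          then have "c \<delta> (\<gamma>, i) \<odot>\<^bsub>M\<^esub> x \<gamma> i = \<zero>\<^bsub>M\<^esub>"
            using base_annihilator[OF \<gamma> i cR] radical[OF \<gamma>] True by simp
          then show ?thesis
            using 2 True top_carrier[OF \<gamma>] by (simp add: a_def top_cong_refl)
        next
          case 3
          then show ?thesis
            using True cR top_carrier[OF \<gamma>] by (simp add: a_def top_cong_refl)
        qed
      qed
      then show "top_cong (c \<delta> p \<odot>\<^bsub>M\<^esub> x (fst p) (snd p))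
          (if snd p = 1 then a \<delta> (fst p) \<odot>\<^bsub>M\<^esub> x (fst p) 1 else \<zero>\<^bsub>M\<^esub>)"
        unfolding p_eq fst_conv snd_conv .
    qed
    also have "(\<Oplus>\<^bsub>M\<^esub>p\<in>base_indices. if snd p = 1 then a \<delta> (fst p) \<odot>\<^bsub>M\<^esub> x (fst p) 1 else \<zero>\<^bsub>M\<^esub>) =
        (\<Oplus>\<^bsub>M\<^esub>p\<in>(\<lambda>\<gamma>. (\<gamma>, 1::nat)) ` {1..m}. if snd p = 1 then a \<delta> (fst p) \<odot>\<^bsub>M\<^esub> x (fst p) 1 else \<zero>\<^bsub>M\<^esub>)"
    proof (rule M.add.finprod_mono_neutral_cong_right)
      show "(\<lambda>\<gamma>. (\<gamma>, 1::nat)) ` {1..m} \<subseteq> base_indices"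
        using length_pos by (auto simp: base_indices_def)
      show "(if snd p = 1 then a \<delta> (fst p) \<odot>\<^bsub>M\<^esub> x (fst p) 1 else \<zero>\<^bsub>M\<^esub>) = \<zero>\<^bsub>M\<^esub>"
        if "p \<in> base_indices - (\<lambda>\<gamma>. (\<gamma>, 1::nat)) ` {1..m}" for p
        using that by (auto simp: base_indices_def image_iff)
      show "(\<lambda>p. if snd p = 1 then a \<delta> (fst p) \<odot>\<^bsub>M\<^esub> x (fst p) 1 else \<zero>\<^bsub>M\<^esub>) \<in> base_indices \<rightarrow> carrier M"
        using a[OF \<delta>] top_carrier by (auto simp: base_indices_def)
    qed (use finite_base_indices in auto)
    also have "\<dots> = (\<Oplus>\<^bsub>M\<^esub>\<gamma>\<in>{1..m}. a \<delta> \<gamma> \<odot>\<^bsub>M\<^esub> x \<gamma> 1)"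
      using a[OF \<delta>] top_carrier by (subst M.finsum_reindex) (auto simp: inj_on_def)
    finally show "top_cong (\<psi> (x \<delta> 1)) (\<Oplus>\<^bsub>M\<^esub>\<gamma>\<in>{1..m}. a \<delta> \<gamma> \<odot>\<^bsub>M\<^esub> x \<gamma> 1)"
      unfolding expansion[OF \<delta>] .
  qed (use \<psi> a in \<open>auto simp: A_def\<close>)
  moreover have "A \<in> U0 R m k"
    using represents_carrier[OF rep] by (auto simp: U0_def A_def a_def coset_zero)
  ultimately show ?thesis
    by blast
qed

text \<open>Replacing each \<open>v j\<close> by a matrix in \<open>\<U>\<^sub>0(X)\<close>, the identity shows that \<open>F\<close> has the zero matrix, so it maps
  the heads into \<open>im \<phi> + ker \<phi>\<close>. The other base elements are images under \<open>\<phi>\<close>, and \<open>F\<close> maps \<open>im \<phi>\<close> into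
  itself.\<close>

lemma identity_maps_to_radical:
  assumes f: "f \<in> carrier (ncpoly_ring (center_ring R) r)"
    and identity: "polynomial_identity_on (center_ring R) r
        (opposite_ring (mat_ring (residue_quotient R) m)) (mat_scalar R m) (U0 R m k) f"
    and v: "v \<in> {1..r} \<rightarrow> carrier (Cen R M \<phi>)"
  defines "F \<equiv> ncpoly_eval (center_ring R) (Cen R M \<phi>) (\<lambda>c. \<lambda>y\<in>carrier M. c \<odot>\<^bsub>M\<^esub> y) f v"
  shows "F \<in> carrier (Cen R M \<phi>)" and "y \<in> carrier M \<Longrightarrow> top_cong (F y) \<zero>\<^bsub>M\<^esub>"
proof -
  have "\<forall>j\<in>{1..r}. \<exists>A\<in>U0 R m k. represents m (\<lambda>\<delta>. x \<delta> 1) (v j) A"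
    using v ex_U0_represents by blast
  then obtain u where u: "\<And>j. j \<in> {1..r} \<Longrightarrow> u j \<in> U0 R m k"
    "\<And>j. j \<in> {1..r} \<Longrightarrow> represents m (\<lambda>\<delta>. x \<delta> 1) (v j) (u j)"
    by metis
  have "represents m (\<lambda>\<delta>. x \<delta> 1) F \<zero>\<^bsub>opposite_ring (mat_ring (residue_quotient R) m)\<^esub>"
    using represents_eval[OF top_carrier f u(2)] identity u(1)
    by (auto simp: F_def polynomial_identity_on_def)
  then obtain a where F: "F \<in> carrier (Cen R M \<phi>)"
    and a: "\<And>\<delta> \<gamma>. \<delta> \<in> {1..m} \<Longrightarrow> \<gamma> \<in> {1..m} \<Longrightarrow> a \<delta> \<gamma> \<in> carrier R"
      "\<And>\<delta> \<gamma>. \<delta> \<in> {1..m} \<Longrightarrow> \<gamma> \<in> {1..m} \<Longrightarrow>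
        \<zero>\<^bsub>opposite_ring (mat_ring (residue_quotient R) m)\<^esub> (\<delta>, \<gamma>) = jacobson_radical R +>\<^bsub>R\<^esub> a \<delta> \<gamma>"
      "\<And>\<delta>. \<delta> \<in> {1..m} \<Longrightarrow> top_cong (F (x \<delta> 1)) (\<Oplus>\<^bsub>M\<^esub>\<gamma>\<in>{1..m}. a \<delta> \<gamma> \<odot>\<^bsub>M\<^esub> x \<gamma> 1)"
    by (rule representsE) blast
  show "F \<in> carrier (Cen R M \<phi>)"
    by (rule F)
  have F_End: "F \<in> carrier (End_ring R M)" and comm: "\<And>y. y \<in> carrier M \<Longrightarrow> F (\<phi> y) = \<phi> (F y)"
    using F by (simp_all add: Cen_iff)
  have top: "top_cong (F (x \<delta> 1)) \<zero>\<^bsub>M\<^esub>" if \<delta>: "\<delta> \<in> {1..m}" for \<delta>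
  proof -
    have "a \<delta> \<gamma> \<odot>\<^bsub>M\<^esub> x \<gamma> 1 = \<zero>\<^bsub>M\<^esub>" if \<gamma>: "\<gamma> \<in> {1..m}" for \<gamma>
    proof -
      have "jacobson_radical R +>\<^bsub>R\<^esub> a \<delta> \<gamma> = jacobson_radical R"
        using a(2)[OF \<delta> \<gamma>] \<delta> \<gamma> by (simp add: opposite_ring_def mat_ring_def FactRing_def)
      then have "a \<delta> \<gamma> \<in> jacobson_radical R"
        using a(1)[OF \<delta> \<gamma>] J.rcos_const_imp_mem by blast
      then show ?thesis
        using base_annihilator[OF \<gamma>, of 1 "a \<delta> \<gamma>"] a(1)[OF \<delta> \<gamma>] length_pos[OF \<gamma>] by simp
    qed
    then have "(\<Oplus>\<^bsub>M\<^esub>\<gamma>\<in>{1..m}. a \<delta> \<gamma> \<odot>\<^bsub>M\<^esub> x \<gamma> 1) = \<zero>\<^bsub>M\<^esub>"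
      by (rule M.add.finprod_one_eqI)
    then show ?thesis
      using a(3)[OF \<delta>] by simp
  qed
  have all: "top_cong (F (x \<gamma> i)) \<zero>\<^bsub>M\<^esub>" if \<gamma>: "\<gamma> \<in> {1..m}" and i: "i \<in> {1..k \<gamma>}" for \<gamma> i
  proof (cases "i = 1")
    case False
    then have "x \<gamma> i = \<phi> (x \<gamma> (i - 1))"
      using phi_base[OF \<gamma>, of "i - 1"] i by auto
    moreover have "x \<gamma> (i - 1) \<in> carrier M"
      using \<gamma> i False by (intro base_carrier) auto
    ultimately show ?thesis
      using comm F_End top_cong_phi by simp
  qed (use top \<gamma> in simp)
  assume "y \<in> carrier M"
  then obtain c where c: "\<And>p. p \<in> base_indices \<Longrightarrow> c p \<in> carrier R" "y = (\<Oplus>\<^bsub>M\<^esub>p\<in>base_indices. c p \<odot>\<^bsub>M\<^esub> x (fst p) (snd p))"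
    using base_span by blast
  have x_closed: "x (fst p) (snd p) \<in> carrier M" if "p \<in> base_indices" for p
    using that by (auto simp: base_indices_def)
  have "F y = (\<Oplus>\<^bsub>M\<^esub>p\<in>base_indices. F (c p \<odot>\<^bsub>M\<^esub> x (fst p) (snd p)))"
    unfolding c(2) using F_End c(1) x_closed by (intro End_finsum) auto
  moreover have "top_cong (\<Oplus>\<^bsub>M\<^esub>p\<in>base_indices. F (c p \<odot>\<^bsub>M\<^esub> x (fst p) (snd p))) (\<Oplus>\<^bsub>M\<^esub>p\<in>base_indices. \<zero>\<^bsub>M\<^esub>)"
  proof (rule top_cong_finsum[OF finite_base_indices])
    fix p assume p: "p \<in> base_indices"
    then have "top_cong (F (x (fst p) (snd p))) \<zero>\<^bsub>M\<^esub>"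
      by (intro all) (auto simp: base_indices_def)
    from top_cong_smult[OF c(1)[OF p] this]
    show "top_cong (F (c p \<odot>\<^bsub>M\<^esub> x (fst p) (snd p))) \<zero>\<^bsub>M\<^esub>"
      using p c(1) x_closed F_End by (simp add: End_smult)
  qed
  ultimately show "top_cong (F y) \<zero>\<^bsub>M\<^esub>"
    by simp
qed

end

section \<open>Products of endomorphisms into the image and the kernel\<close>

context module_endomorphism
begin

text \<open>The inductive step moves \<open>g\<close> next to a power of \<open>\<phi>\<close>, one factor of which is turned into
  \<open>\<phi>\<^sup>2\<close> by the hypothesis on \<open>g\<close>.\<close>

lemma radical_product_depth:
  assumes "set gs \<subseteq> carrier (Cen R M \<phi>)"
    and "\<And>g y. g \<in> set gs \<Longrightarrow> y \<in> carrier M \<Longrightarrow> top_cong (g y) \<zero>\<^bsub>M\<^esub>"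
    and "y \<in> carrier M"
  shows "\<exists>z\<in>carrier M. \<phi> (list_product (Cen R M \<phi>) gs y) = (\<phi> ^^ Suc (length gs)) z"
  using assms
proof (induction gs arbitrary: y)
  case Nil
  then show ?case
    by auto
next
  case (Cons g gs)
  let ?P = "list_product (Cen R M \<phi>) gs"
  have g: "g \<in> carrier (End_ring R M)" and P: "?P \<in> carrier (End_ring R M)"
    using Cons.prems(1) Cen.list_product_closed[of gs] by (auto simp: Cen_iff)
  obtain z where z: "z \<in> carrier M" "\<phi> (?P y) = (\<phi> ^^ Suc (length gs)) z"
    using Cons.IH[of y] Cons.prems by auto
  obtain w where w: "w \<in> carrier M" "\<phi> (g z) = \<phi> (\<phi> w)"
    using Cons.prems(2)[of g z] z(1) by (auto elim!: top_congE)
  have "\<phi> (list_product (Cen R M \<phi>) (g # gs) y) = \<phi> (g (?P y))"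
    using Cons.prems(3) by simp
  also have "\<dots> = g (\<phi> (?P y))"
    using Cons.prems(1) P Cons.prems(3) by (simp add: Cen_iff)
  also have "\<dots> = (\<phi> ^^ Suc (length gs)) (g z)"
    unfolding z(2) using Cons.prems(1) z(1) by (intro Cen_commute_pow[symmetric]) simp_all
  also have "\<dots> = (\<phi> ^^ length gs) (\<phi> (\<phi> w))"
    unfolding funpow_Suc_right comp_apply w(2) ..
  also have "\<dots> = (\<phi> ^^ Suc (length (g # gs))) w"
    by (simp add: funpow_swap1)
  finally show ?case
    using w(1) by blast
qed

lemma End_pow_apply:
  assumes "y \<in> carrier M"
  shows "(\<phi> [^]\<^bsub>End_ring R M\<^esub> (d::nat)) y = (\<phi> ^^ d) y"
  using assms by (induction d arbitrary: y) (simp_all add: funpow_swap1)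

end

theorem theorem3p8:
  fixes R :: "('a, 'b) ring_scheme"
    and M :: "('a, 'm, 'c) module_scheme"
    and \<phi> :: "'m \<Rightarrow> 'm"
    and n m r :: nat
    and k :: "nat \<Rightarrow> nat"
    and x :: "nat \<Rightarrow> nat \<Rightarrow> 'm"
    and f :: "nat \<Rightarrow> nat list \<Rightarrow> 'a"
  assumes "is_local_ring R"
    and "left_module R M"
    and "finitely_generated_module R M"
    and "semisimple_module R M"
    and "\<phi> \<in> carrier (End_ring R M)"
    and "nilpotent_of_index (End_ring R M) \<phi> n"
    and "nilpotent_jordan_base R M \<phi> {1..m} k x"
    and "\<And>\<gamma> \<delta>. 1 \<le> \<gamma> \<Longrightarrow> \<gamma> \<le> \<delta> \<Longrightarrow> \<delta> \<le> m \<Longrightarrow> k \<delta> \<le> k \<gamma>"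
    and "\<And>i. 1 \<le> i \<Longrightarrow> i \<le> n - 1 \<Longrightarrow> f i \<in> carrier (ncpoly_ring (center_ring R) r)"
    and "\<And>i. 1 \<le> i \<Longrightarrow> i \<le> n - 1 \<Longrightarrow>
      polynomial_identity_on (center_ring R) r
        (opposite_ring (mat_ring (residue_quotient R) m)) (mat_scalar R m)
        (U0 R m k) (f i)"
  shows "polynomial_identity_on (center_ring R) r
      (Cen R M \<phi> Quot Cen0 R M \<phi>) (Cen_quot_scalar R M \<phi>)
      (carrier (Cen R M \<phi> Quot Cen0 R M \<phi>))
      (list_product (ncpoly_ring (center_ring R) r) (map f [1..<n]))"
proof -
  interpret jordan_module R M \<phi> m k x
    using assms by unfold_locales
  interpret poly: central_algebra "center_ring R" "Cen R M \<phi>" "\<lambda>c. \<lambda>y\<in>carrier M. c \<odot>\<^bsub>M\<^esub> y"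
    by (rule Cen_scalar_algebra)
  let ?Q = "Cen R M \<phi> Quot Cen0 R M \<phi>" and ?\<pi> = "(+>\<^bsub>Cen R M \<phi>\<^esub>) (Cen0 R M \<phi>)"
  let ?f = "list_product (ncpoly_ring (center_ring R) r) (map f [1..<n])"
  let ?eval = "ncpoly_eval (center_ring R) (Cen R M \<phi>) (\<lambda>c. \<lambda>y\<in>carrier M. c \<odot>\<^bsub>M\<^esub> y)"
  interpret \<pi>: ring_hom_ring "Cen R M \<phi>" ?Q ?\<pi>
    by (rule Cen0.rcos_ring_hom_ring)
  have fs: "set (map f [1..<n]) \<subseteq> carrier (ncpoly_ring (center_ring R) r)"
    using assms(9) by auto
  have nil: "(\<phi> ^^ n) z = \<zero>\<^bsub>M\<^esub>" if "z \<in> carrier M" for z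
    using assms(6) End_pow_apply[OF that, of n] that by (simp add: nilpotent_of_index_def)
  have n: "1 \<le> n"
    using assms(6) by (simp add: nilpotent_of_index_def)
  have "ncpoly_eval (center_ring R) ?Q (Cen_quot_scalar R M \<phi>) ?f v = \<zero>\<^bsub>?Q\<^esub>"
    if v: "v \<in> {1..r} \<rightarrow> carrier ?Q" for v
  proof -
    have "carrier ?Q = ?\<pi> ` carrier (Cen R M \<phi>)"
      by (auto simp: FactRing_def A_RCOSETS_def')
    then have "\<forall>j\<in>{1..r}. \<exists>\<psi>\<in>carrier (Cen R M \<phi>). v j = ?\<pi> \<psi>"
      using v by blast
    then obtain u where u: "\<And>j. j \<in> {1..r} \<Longrightarrow> u j \<in> carrier (Cen R M \<phi>)"
      "\<And>j. j \<in> {1..r} \<Longrightarrow> v j = ?\<pi> (u j)"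
      by metis
    \<comment> \<open>The values in the factor ring are the classes of the values at representatives \<open>u\<close>, so it suffices to work in \<open>Cen(\<phi>)\<close>.\<close>
    let ?g = "\<lambda>i. ?eval (f i) u"
    have u_fun: "u \<in> {1..r} \<rightarrow> carrier (Cen R M \<phi>)"
      using u(1) by blast
    have rel: "?eval ?f u \<in> carrier (Cen R M \<phi>) \<and>
        ncpoly_eval (center_ring R) ?Q (Cen_quot_scalar R M \<phi>) ?f v = ?\<pi> (?eval ?f u)"
      by (rule ncpoly_eval_related[where P = "\<lambda>\<psi> C. \<psi> \<in> carrier (Cen R M \<phi>) \<and> C = ?\<pi> \<psi>"])
        (use u poly.R.ncpoly_list_product_closed[OF fs] Cen.abelian_monoid_axioms \<pi>.S.abelian_monoid_axioms
          in \<open>auto simp: Cen_quot_scalar_def simp del: Cen_ops\<close>)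
    have eval: "?eval ?f u = list_product (Cen R M \<phi>) (map ?g [1..<n])"
      using poly.ncpoly_eval_list_product[OF fs u_fun] by (simp add: comp_def)
    have g: "?g i \<in> carrier (Cen R M \<phi>)" "y \<in> carrier M \<Longrightarrow> top_cong (?g i y) \<zero>\<^bsub>M\<^esub>"
      if "i \<in> set [1..<n]" for i y
    proof -
      have "1 \<le> i" "i \<le> n - 1"
        using that by auto
      from identity_maps_to_radical[OF assms(9)[OF this] assms(10)[OF this] u_fun]
      show "?g i \<in> carrier (Cen R M \<phi>)" "y \<in> carrier M \<Longrightarrow> top_cong (?g i y) \<zero>\<^bsub>M\<^esub>"
        by blast+
    qed
    have kill: "\<phi> (?eval ?f u y) = \<zero>\<^bsub>M\<^esub>" if y: "y \<in> carrier M" for y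
    proof -
      have "set (map ?g [1..<n]) \<subseteq> carrier (Cen R M \<phi>)"
        using g(1) by auto
      then have "\<exists>z\<in>carrier M. \<phi> (?eval ?f u y) = (\<phi> ^^ Suc (length (map ?g [1..<n]))) z"
        unfolding eval by (rule radical_product_depth) (use g(2) y in auto)
      then show ?thesis
        using n nil by auto
    qed
    have "?eval ?f u \<in> Cen0 R M \<phi>"
    proof -
      have F: "?eval ?f u \<in> carrier (End_ring R M)" and comm: "\<And>y. y \<in> carrier M \<Longrightarrow> ?eval ?f u (\<phi> y) = \<phi> (?eval ?f u y)"
        using rel by (simp_all add: Cen_iff)
      show ?thesis
        unfolding Cen0_def using F comm kill endo
        by (auto intro!: End_eqI End_ops_closed End_unit_closed)
    qed
    then show ?thesis
      using rel Cen0.a_rcos_const by (simp add: FactRing_def)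
  qed
  then show ?thesis
    by (simp add: polynomial_identity_on_def)
qed

end
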